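(* Let $G$ be a biconnected series-parallel graph without transitive edges. The following are equivalent: (1) every separation pair of $G$ has at most two heavy components (i.e., $G$ is at most 2-heavy); (2) $G$ admits a grounded string representation (i.e., $G$ is outerstring); (3) $G$ admits a grounded L-$\Gamma$-mirror representation, i.e., a grounded string representation in which every curve is an orthogonal polyline with at most one bend, the bend (if any) being a bottommost point of the curve.
   Context: A grounded string representation of a graph $G$: there is a horizontal line $\ell$; each vertex $v$ is represented by a simple curve lying below $\ell$ with exactly one endpoint (its anchor) on $\ell$, and two curves intersect if and only if the corresponding vertices are adjacent. In (3), each curve thus consists of a vertical segment from its anchor downward, possibly followed by one horizontal segment going left or right (an "L" or a mirrored "L"). A biconnected graph is series-parallel if it contains no subdivision of $K_4$. A separation pair of a biconnected graph $G$ is a pair $(s,t)$ of vertices with $G-s-t$ disconnected; a transitive edge is an edge joining the two vertices of a separation pair. A component w.r.t. $(s,t)$ is the subgraph induced by $s$, $t$ and the vertex set of one connected component of $G-s-t$; vertices other than $s,t$ are internal. A component is heavy if it has an internal vertex adjacent to neither $s$ nor $t$, and light otherwise. $G$ is at most 2-heavy if every separation pair has at most two heavy components. *)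

theory Defs
  imports "HOL-Analysis.Analysis"
begin

(* A finite simple graph: vertex set V, symmetric irreflexive adjacency E on V. *)
definition simple_graph :: "'a set \<Rightarrow> ('a \<Rightarrow> 'a \<Rightarrow> bool) \<Rightarrow> bool" where
  "simple_graph V E \<longleftrightarrow> finite V \<and> (\<forall>x y. E x y \<longrightarrow> x \<in> V \<and> y \<in> V)
     \<and> (\<forall>x y. E x y \<longrightarrow> E y x) \<and> (\<forall>x. \<not> E x x)"

(* adjacency restricted to the induced subgraph on W *)
definition induced_rel :: "('a \<Rightarrow> 'a \<Rightarrow> bool) \<Rightarrow> 'a set \<Rightarrow> ('a \<times> 'a) set" where
  "induced_rel E W = {(x, y). x \<in> W \<and> y \<in> W \<and> E x y}"

(* the induced subgraph G[W] is connected *)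
definition connected_on :: "('a \<Rightarrow> 'a \<Rightarrow> bool) \<Rightarrow> 'a set \<Rightarrow> bool" where
  "connected_on E W \<longleftrightarrow> (\<forall>x\<in>W. \<forall>y\<in>W. (x, y) \<in> (induced_rel E W)\<^sup>*)"

(* vertex sets of the connected components of G[W] *)
definition components_of :: "('a \<Rightarrow> 'a \<Rightarrow> bool) \<Rightarrow> 'a set \<Rightarrow> 'a set set" where
  "components_of E W = {C. \<exists>x\<in>W. C = {y \<in> W. (x, y) \<in> (induced_rel E W)\<^sup>*}}"

(* biconnected = 2-connected: more than 2 vertices, connected, and no cut vertex *)
definition biconnected :: "'a set \<Rightarrow> ('a \<Rightarrow> 'a \<Rightarrow> bool) \<Rightarrow> bool" where
  "biconnected V E \<longleftrightarrow> card V \<ge> 3 \<and> connected_on E V \<and> (\<forall>v\<in>V. connected_on E (V - {v}))"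

(* a path in G: a list of distinct vertices, consecutive ones adjacent *)
definition is_path :: "('a \<Rightarrow> 'a \<Rightarrow> bool) \<Rightarrow> 'a list \<Rightarrow> bool" where
  "is_path E p \<longleftrightarrow> distinct p \<and> successively E p"

(* G contains a subdivision of K4 as a subgraph: four distinct branch vertices b 0..b 3
   and six internally disjoint paths p i j (i<j<4) from b i to b j whose internal
   vertices avoid all branch vertices *)
definition has_K4_subdivision :: "'a set \<Rightarrow> ('a \<Rightarrow> 'a \<Rightarrow> bool) \<Rightarrow> bool" where
  "has_K4_subdivision V E \<longleftrightarrow>
     (\<exists>(b :: nat \<Rightarrow> 'a) (p :: nat \<Rightarrow> nat \<Rightarrow> 'a list).
        inj_on b {..<4} \<and> b ` {..<4} \<subseteq> V \<and>
        (\<forall>i j. i < j \<and> j < 4 \<longrightarrow>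
           is_path E (p i j) \<and> length (p i j) \<ge> 2 \<and>
           hd (p i j) = b i \<and> last (p i j) = b j \<and>
           set (p i j) \<inter> b ` {..<4} = {b i, b j}) \<and>
        (\<forall>i j k l. i < j \<and> j < 4 \<and> k < l \<and> l < 4 \<and> (i, j) \<noteq> (k, l) \<longrightarrow>
           set (p i j) \<inter> set (p k l) \<subseteq> b ` {..<4}))"

(* biconnected series-parallel: no subdivision of K4 *)
definition series_parallel :: "'a set \<Rightarrow> ('a \<Rightarrow> 'a \<Rightarrow> bool) \<Rightarrow> bool" where
  "series_parallel V E \<longleftrightarrow> \<not> has_K4_subdivision V E"

definition separation_pair :: "'a set \<Rightarrow> ('a \<Rightarrow> 'a \<Rightarrow> bool) \<Rightarrow> 'a \<Rightarrow> 'a \<Rightarrow> bool" where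
  "separation_pair V E s t \<longleftrightarrow> s \<in> V \<and> t \<in> V \<and> s \<noteq> t \<and> \<not> connected_on E (V - {s, t})"

definition no_transitive_edges :: "'a set \<Rightarrow> ('a \<Rightarrow> 'a \<Rightarrow> bool) \<Rightarrow> bool" where
  "no_transitive_edges V E \<longleftrightarrow> (\<forall>s t. separation_pair V E s t \<longrightarrow> \<not> E s t)"

(* a component w.r.t. (s,t), given by the internal vertex set C, is heavy if some internal
   vertex is adjacent to neither s nor t *)
definition heavy :: "('a \<Rightarrow> 'a \<Rightarrow> bool) \<Rightarrow> 'a \<Rightarrow> 'a \<Rightarrow> 'a set \<Rightarrow> bool" where
  "heavy E s t C \<longleftrightarrow> (\<exists>v\<in>C. \<not> E v s \<and> \<not> E v t)"

definition at_most_2_heavy :: "'a set \<Rightarrow> ('a \<Rightarrow> 'a \<Rightarrow> bool) \<Rightarrow> bool" where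
  "at_most_2_heavy V E \<longleftrightarrow> (\<forall>s t. separation_pair V E s t \<longrightarrow>
      card {C \<in> components_of E (V - {s, t}). heavy E s t C} \<le> 2)"

(* grounded string representation w.r.t. the horizontal line y = c: each vertex v gets a
   simple curve (arc) gamma v whose start point (anchor) lies on the line and all of whose
   other points lie strictly below it; distinct curves meet iff the vertices are adjacent *)
definition grounded_string_rep ::
  "'a set \<Rightarrow> ('a \<Rightarrow> 'a \<Rightarrow> bool) \<Rightarrow> real \<Rightarrow> ('a \<Rightarrow> real \<Rightarrow> real \<times> real) \<Rightarrow> bool" where
  "grounded_string_rep V E c \<gamma> \<longleftrightarrow>
     (\<forall>v\<in>V. arc (\<gamma> v) \<and> snd (pathstart (\<gamma> v)) = c \<and>
             (\<forall>\<tau>\<in>{0<..1}. snd (\<gamma> v \<tau>) < c)) \<and>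
     (\<forall>u\<in>V. \<forall>v\<in>V. u \<noteq> v \<longrightarrow>
             (path_image (\<gamma> u) \<inter> path_image (\<gamma> v) \<noteq> {} \<longleftrightarrow> E u v))"

definition outerstring :: "'a set \<Rightarrow> ('a \<Rightarrow> 'a \<Rightarrow> bool) \<Rightarrow> bool" where
  "outerstring V E \<longleftrightarrow> (\<exists>c \<gamma>. grounded_string_rep V E c \<gamma>)"

(* an L-shaped (or mirrored L) curve: vertical segment going down from an anchor on y = c,
   possibly followed by one horizontal segment (x' = x gives no horizontal part) *)
definition L_shape :: "real \<Rightarrow> (real \<times> real) set \<Rightarrow> bool" where
  "L_shape c S \<longleftrightarrow> (\<exists>x y x'. y < c \<and>
       S = closed_segment (x, c) (x, y) \<union> closed_segment (x, y) (x', y))"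

definition grounded_L_mirror_rep :: "'a set \<Rightarrow> ('a \<Rightarrow> 'a \<Rightarrow> bool) \<Rightarrow> bool" where
  "grounded_L_mirror_rep V E \<longleftrightarrow>
     (\<exists>c \<gamma>. grounded_string_rep V E c \<gamma> \<and> (\<forall>v\<in>V. L_shape c (path_image (\<gamma> v))))"

end

theory Submission
  imports Defs
begin

text \<open>
  Necessity: a heavy component of \<open>(s, t)\<close> contains a vertex \<open>v\<close> nonadjacent to \<open>s\<close> and \<open>t\<close>, joined to \<open>s\<close> inside
  the component avoiding \<open>N(t)\<close>, and to \<open>t\<close> avoiding \<open>N(s)\<close>. Among three such vertices, two are
  anchored on the same side of the anchors of \<open>s\<close> and \<open>t\<close>, and then the connection of one of them to
  \<open>s\<close> and of the other to \<open>t\<close> must cross.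

  Sufficiency: the internal part of a component of \<open>(u, v)\<close> is cut by a vertex \<open>d\<close> into parts
  attached to \<open>(u, d)\<close> and \<open>(d, v)\<close>. Recursing on these parts from a suitable root edge, the curves
  are placed from the deepest to the shallowest; at each pair the light components, which are stars,
  go first and the at most one heavy component away from the root goes last.
\<close>

subsection \<open>Connectedness and \<open>K\<^sub>4\<close> minors\<close>

text \<open>Placing curves by decreasing depth turns the geometry into a condition on lists: the
  earlier neighbours of a new vertex must form one block beside its anchor. A pair in the recursion
  can accommodate one heavy component, whereas the hypothesis allows two. So whenever a pair has
  two, the root edge must meet one of them, and an arbitrary edge may fail this by lying in a third,
  light component. The remedy is extremal: among the heavy components whose pair has another heavy
  component and a third component besides, take a smallest \<open>H\<close> and a root edge from its
  pair into \<open>H\<close>. A pair disjoint from \<open>H\<close> has a heavy component containing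
  \<open>H\<close>, hence at most one other; a pair meeting \<open>H\<close> with two heavy
  components away from the root would yield a smaller choice. If no such \<open>H\<close> exists,
  every edge serves.\<close>

lemma connected_on_cut:
  "connected_on E W \<longleftrightarrow> (\<forall>X\<subseteq>W. X \<noteq> {} \<longrightarrow> X \<noteq> W \<longrightarrow> (\<exists>x\<in>X. \<exists>y\<in>W - X. E x y))"
proof
  assume con: "connected_on E W"
  show "\<forall>X\<subseteq>W. X \<noteq> {} \<longrightarrow> X \<noteq> W \<longrightarrow> (\<exists>x\<in>X. \<exists>y\<in>W - X. E x y)"
  proof (intro allI impI)
    fix X assume X: "X \<subseteq> W" "X \<noteq> {}" "X \<noteq> W"
    then obtain x y where xy: "x \<in> X" "y \<in> W - X" by blast
    then have "(x, y) \<in> (induced_rel E W)\<^sup>*" using con X by (auto simp: connected_on_def)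
    then have "y \<notin> X \<longrightarrow> (\<exists>x\<in>X. \<exists>y\<in>W - X. E x y)"
      by (induction rule: rtrancl_induct) (use xy in \<open>auto simp: induced_rel_def\<close>)
    then show "\<exists>x\<in>X. \<exists>y\<in>W - X. E x y" using xy by blast
  qed
next
  assume cut: "\<forall>X\<subseteq>W. X \<noteq> {} \<longrightarrow> X \<noteq> W \<longrightarrow> (\<exists>x\<in>X. \<exists>y\<in>W - X. E x y)"
  show "connected_on E W" unfolding connected_on_def
  proof (intro ballI)
    fix x y assume xy: "x \<in> W" "y \<in> W"
    let ?X = "{z \<in> W. (x, z) \<in> (induced_rel E W)\<^sup>*}"
    have "\<not> (\<exists>a\<in>?X. \<exists>b\<in>W - ?X. E a b)"
      by (auto simp: induced_rel_def intro: rtrancl_into_rtrancl)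
    moreover have "?X \<subseteq> W" "?X \<noteq> {}" using xy by auto
    ultimately have "?X = W" using cut by blast
    then show "(x, y) \<in> (induced_rel E W)\<^sup>*" using xy by blast
  qed
qed

lemma connected_on_cutD:
  assumes "connected_on E W" "X \<subseteq> W" "x \<in> X" "y \<in> W" "y \<notin> X"
  shows "\<exists>a\<in>X. \<exists>b\<in>W - X. E a b"
  using assms unfolding connected_on_cut by blast

lemma connected_on_singleton [simp]: "connected_on E {x}"
  by (simp add: connected_on_def)

lemma connected_on_closed_eq:
  assumes "connected_on E W" "X \<subseteq> W" "X \<noteq> {}" "\<And>x y. x \<in> X \<Longrightarrow> y \<in> W \<Longrightarrow> E x y \<Longrightarrow> y \<in> X"
  shows "X = W"
  using assms unfolding connected_on_cut by blast

lemma connected_on_path: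
  assumes "connected_on E W" "x \<in> W" "y \<in> W"
  obtains p where "is_path E p" "p \<noteq> []" "hd p = x" "last p = y" "set p \<subseteq> W"
proof -
  have "(x, y) \<in> (induced_rel E W)\<^sup>*" using assms by (simp add: connected_on_def)
  then have "\<exists>p. is_path E p \<and> p \<noteq> [] \<and> hd p = x \<and> last p = y \<and> set p \<subseteq> W"
  proof (induction rule: rtrancl_induct)
    case base
    show ?case by (rule exI[of _ "[x]"]) (use assms in \<open>auto simp: is_path_def\<close>)
  next
    case (step y z)
    then obtain p where p: "is_path E p" "p \<noteq> []" "hd p = x" "last p = y" "set p \<subseteq> W" by blast
    show ?case
    proof (cases "z \<in> set p")
      case True
      then obtain q r where qr: "p = q @ z # r" by (auto simp: in_set_conv_decomp)
      show ?thesis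
        by (rule exI[of _ "q @ [z]"])
          (use p in \<open>auto simp: qr is_path_def successively_append_iff hd_append\<close>)
    next
      case False
      show ?thesis
        by (rule exI[of _ "p @ [z]"])
          (use p step False in \<open>auto simp: is_path_def successively_append_iff induced_rel_def\<close>)
    qed
  qed
  then show thesis using that by blast
qed

locale sgraph =
  fixes V :: "'a set" and E :: "'a \<Rightarrow> 'a \<Rightarrow> bool"
  assumes simple: "simple_graph V E"
begin

lemma fin: "finite V" and adj_sym: "E x y \<Longrightarrow> E y x" and irrefl: "\<not> E x x"
  and adjV: "E x y \<Longrightarrow> x \<in> V" "E x y \<Longrightarrow> y \<in> V"
  using simple by (auto simp: simple_graph_def)

lemma successively_adj_rev: "successively E (rev p) = successively E p"
proof -
  have "(\<lambda>x y. E y x) = E" using adj_sym by (auto simp: fun_eq_iff)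
  then show ?thesis by (simp only: successively_rev)
qed

lemma connected_on_Un:
  assumes "connected_on E X" "connected_on E Y" "x \<in> X" "y \<in> Y" "x = y \<or> E x y"
  shows "connected_on E (X \<union> Y)"
  unfolding connected_on_cut
proof (intro allI impI)
  fix Z assume Z: "Z \<subseteq> X \<union> Y" "Z \<noteq> {}" "Z \<noteq> X \<union> Y"
  have X: "Z \<inter> X = {} \<or> Z \<inter> X = X \<or> (\<exists>a\<in>Z \<inter> X. \<exists>b\<in>X - Z. E a b)"
    using assms(1) unfolding connected_on_cut by (drule_tac spec[of _ "Z \<inter> X"]) blast
  have Y: "Z \<inter> Y = {} \<or> Z \<inter> Y = Y \<or> (\<exists>a\<in>Z \<inter> Y. \<exists>b\<in>Y - Z. E a b)"
    using assms(2) unfolding connected_on_cut by (drule_tac spec[of _ "Z \<inter> Y"]) blast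
  show "\<exists>a\<in>Z. \<exists>b\<in>X \<union> Y - Z. E a b"
    using X Y Z assms(3-5) adj_sym by blast
qed

lemma connected_on_insert:
  assumes "connected_on E X" "x \<in> X" "E x y"
  shows "connected_on E (insert y X)"
  using connected_on_Un[OF assms(1) connected_on_singleton[of E y] assms(2), of y] assms(3) by simp

lemma connected_on_set_path:
  "successively E p \<Longrightarrow> connected_on E (set p)"
proof (induction p)
  case (Cons a p)
  show ?case
  proof (cases p)
    case (Cons b q)
    then show ?thesis using Cons.prems Cons.IH connected_on_insert[of "set p" b a] adj_sym by simp
  qed simp
qed (simp add: connected_on_def)

lemma components_of_iff:
  "C \<in> components_of E W \<longleftrightarrow>
     C \<noteq> {} \<and> C \<subseteq> W \<and> connected_on E C \<and> (\<forall>x\<in>C. \<forall>y\<in>W. E x y \<longrightarrow> y \<in> C)"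
proof
  assume "C \<in> components_of E W"
  then obtain x where x: "x \<in> W" and C: "C = {y \<in> W. (x, y) \<in> (induced_rel E W)\<^sup>*}"
    by (auto simp: components_of_def)
  have "connected_on E C"
    unfolding connected_on_cut
  proof (intro allI impI)
    fix X assume X: "X \<subseteq> C" "X \<noteq> {}" "X \<noteq> C"
    define Y where "Y = (if x \<in> X then X else C - X)"
    have xY: "x \<in> Y" and YC: "Y \<subseteq> C" "Y \<noteq> C" using X x C by (auto simp: Y_def)
    then obtain y where y: "y \<in> C" "y \<notin> Y" by blast
    then have "(x, y) \<in> (induced_rel E W)\<^sup>*" using C by blast
    then have "y \<notin> Y \<longrightarrow> (\<exists>a\<in>Y. \<exists>b\<in>C - Y. E a b)"
    proof (induction rule: rtrancl_induct)
      case base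
      then show ?case using xY by blast
    next
      case (step y z)
      then have "z \<in> C" by (auto simp: C induced_rel_def intro: rtrancl_into_rtrancl)
      then show ?case using step by (auto simp: induced_rel_def)
    qed
    then obtain a b' where "a \<in> Y" "b' \<in> C - Y" "E a b'" using y by blast
    then show "\<exists>a\<in>X. \<exists>b\<in>C - X. E a b"
      using X adj_sym[of a b'] by (cases "x \<in> X") (auto simp: Y_def)
  qed
  then show "C \<noteq> {} \<and> C \<subseteq> W \<and> connected_on E C \<and> (\<forall>x\<in>C. \<forall>y\<in>W. E x y \<longrightarrow> y \<in> C)"
    using x by (auto simp: C induced_rel_def intro: rtrancl_into_rtrancl)
next
  assume C: "C \<noteq> {} \<and> C \<subseteq> W \<and> connected_on E C \<and> (\<forall>x\<in>C. \<forall>y\<in>W. E x y \<longrightarrow> y \<in> C)"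
  then obtain x where x: "x \<in> C" by blast
  have mono: "(induced_rel E C)\<^sup>* \<subseteq> (induced_rel E W)\<^sup>*"
    by (rule rtrancl_mono) (use C in \<open>auto simp: induced_rel_def\<close>)
  have "y \<in> C" if "(x, y) \<in> (induced_rel E W)\<^sup>*" for y
    using that by (induction rule: rtrancl_induct) (use x C in \<open>auto simp: induced_rel_def\<close>)
  moreover have "(x, y) \<in> (induced_rel E W)\<^sup>*" if "y \<in> C" for y
    using C x that mono by (auto simp: connected_on_def)
  ultimately have "C = {y \<in> W. (x, y) \<in> (induced_rel E W)\<^sup>*}" using C by blast
  then show "C \<in> components_of E W" using x C by (auto simp: components_of_def)
qed

lemma component_exists: "x \<in> W \<Longrightarrow> \<exists>C\<in>components_of E W. x \<in> C"
  by (auto simp: components_of_def)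

lemma components_disjoint:
  assumes "C \<in> components_of E W" "C' \<in> components_of E W" "x \<in> C" "x \<in> C'"
  shows "C = C'"
proof -
  have "C \<inter> C' = C"
    by (rule connected_on_closed_eq[of E]) (use assms in \<open>auto simp: components_of_iff\<close>)
  moreover have "C \<inter> C' = C'"
    by (rule connected_on_closed_eq[of E]) (use assms in \<open>auto simp: components_of_iff\<close>)
  ultimately show ?thesis by simp
qed

text \<open>Follow a path from \<open>c\<close> towards \<open>a\<close> until it first hits a path
  from \<open>a\<close> to \<open>b\<close>; the vertex \<open>w\<close> hit there is the centre,
  possibly equal to one of the three given vertices.\<close>

lemma tripod:
  assumes con: "connected_on E X" and a: "a \<in> X" "b \<in> X" "c \<in> X"
  obtains w p q r where
    "is_path E p" "p \<noteq> []" "hd p = w" "last p = a" "set p \<subseteq> X"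
    "is_path E q" "q \<noteq> []" "hd q = w" "last q = b" "set q \<subseteq> X"
    "is_path E r" "r \<noteq> []" "hd r = w" "last r = c" "set r \<subseteq> X"
    "set p \<inter> set q = {w}" "set p \<inter> set r = {w}" "set q \<inter> set r = {w}"
proof -
  obtain P where P: "is_path E P" "P \<noteq> []" "hd P = a" "last P = b" "set P \<subseteq> X"
    using connected_on_path[OF con a(1,2)] by blast
  obtain Q where Q: "is_path E Q" "Q \<noteq> []" "hd Q = c" "last Q = a" "set Q \<subseteq> X"
    using connected_on_path[OF con a(3,1)] by blast
  have "\<exists>x\<in>set Q. x \<in> set P"
    using P Q by (intro bexI[of _ a]) (metis hd_in_set, metis last_in_set)
  then obtain Q1 w Q2 where Q': "Q = Q1 @ w # Q2" "w \<in> set P" "\<forall>x\<in>set Q1. x \<notin> set P"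
    using split_list_first_prop[of Q "\<lambda>x. x \<in> set P"] by blast
  then obtain P1 P2 where P': "P = P1 @ w # P2" by (auto simp: in_set_conv_decomp)
  show thesis
  proof (rule that[of "w # rev P1" w "w # P2" "w # rev Q1"])
    have "successively E (P1 @ [w])" "successively E (Q1 @ [w])"
      using P(1) Q(1) by (auto simp: P' Q' is_path_def successively_append_iff)
    then have "successively E (w # rev P1)" "successively E (w # rev Q1)"
      using successively_adj_rev[of "P1 @ [w]"] successively_adj_rev[of "Q1 @ [w]"] by simp_all
    then show "is_path E (w # rev P1)" "is_path E (w # rev Q1)"
      using P(1) Q(1) by (auto simp: P' Q' is_path_def)
    show "last (w # rev P1) = a" using P by (cases P1) (auto simp: P')
    show "last (w # rev Q1) = c" using Q by (cases Q1) (auto simp: Q')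
  qed (use P Q Q' in \<open>auto simp: P' is_path_def successively_append_iff\<close>)
qed

text \<open>Every vertex of \<open>K\<^sub>4\<close> has degree three, so a branch set has to join
  only three attachment vertices. A tripod in \<open>X i\<close> does this: its centre becomes the
  branch vertex \<open>b i\<close>, and its legs \<open>q i j\<close> share nothing else.\<close>

lemma K4_minor_imp_subdivision:
  fixes X :: "nat \<Rightarrow> 'a set"
  assumes con: "\<And>i. i < 4 \<Longrightarrow> connected_on E (X i)"
    and sub: "\<And>i. i < 4 \<Longrightarrow> X i \<subseteq> V"
    and dis: "\<And>i j. i < j \<Longrightarrow> j < 4 \<Longrightarrow> X i \<inter> X j = {}"
    and adj: "\<And>i j. i < j \<Longrightarrow> j < 4 \<Longrightarrow> \<exists>x\<in>X i. \<exists>y\<in>X j. E x y"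
  shows "has_K4_subdivision V E"
proof -
  have dis': "X i \<inter> X j = {}" if "i \<noteq> j" "i < 4" "j < 4" for i j
    using dis[of i j] dis[of j i] that by (cases "i < j") auto
  have "\<forall>i j. \<exists>a. i < j \<longrightarrow> j < 4 \<longrightarrow> fst a \<in> X i \<and> snd a \<in> X j \<and> E (fst a) (snd a)"
    using adj by fastforce
  then obtain a0 where a0: "\<And>i j. i < j \<Longrightarrow> j < 4 \<Longrightarrow>
      fst (a0 i j) \<in> X i \<and> snd (a0 i j) \<in> X j \<and> E (fst (a0 i j)) (snd (a0 i j))"
    unfolding choice_iff by blast
  define a where "a i j = (if i < j then fst (a0 i j) else snd (a0 j i))" for i j
  have aX: "a i j \<in> X i" if "i \<noteq> j" "i < 4" "j < 4" for i j
    using a0[of i j] a0[of j i] that by (auto simp: a_def)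
  have aE: "E (a i j) (a j i)" if "i \<noteq> j" "i < 4" "j < 4" for i j
    using a0[of i j] a0[of j i] that adj_sym by (auto simp: a_def)
  have ex: "\<exists>w q. \<forall>j<4. j \<noteq> i \<longrightarrow> is_path E (q j) \<and> q j \<noteq> [] \<and> hd (q j) = w \<and> last (q j) = a i j
      \<and> set (q j) \<subseteq> X i \<and> (\<forall>k<4. k \<noteq> i \<longrightarrow> k \<noteq> j \<longrightarrow> set (q j) \<inter> set (q k) = {w})" if i: "i < 4" for i
  proof -
    obtain j k l where jkl: "{..<4} - {i} = {j, k, l}" "j \<noteq> k" "j \<noteq> l" "k \<noteq> l"
    proof -
      have "card ({..<4} - {i}) = 3" using i by simp
      then show thesis using that unfolding card_3_iff by blast
    qed
    then have jkl': "j < 4" "k < 4" "l < 4" "j \<noteq> i" "k \<noteq> i" "l \<noteq> i" by auto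
    obtain w p q r where t:
    "is_path E p" "p \<noteq> []" "hd p = w" "last p = a i j" "set p \<subseteq> X i"
    "is_path E q" "q \<noteq> []" "hd q = w" "last q = a i k" "set q \<subseteq> X i"
    "is_path E r" "r \<noteq> []" "hd r = w" "last r = a i l" "set r \<subseteq> X i"
    "set p \<inter> set q = {w}" "set p \<inter> set r = {w}" "set q \<inter> set r = {w}"
      by (rule tripod[OF con[OF i] aX[of i j] aX[of i k] aX[of i l]]) (use i jkl' in auto)
    have "x < 4 \<and> x \<noteq> i \<longleftrightarrow> x = j \<or> x = k \<or> x = l" for x
      using eqset_imp_iff[OF jkl(1), of x] by simp
    then have eq: "(\<forall>x<4. x \<noteq> i \<longrightarrow> P x) \<longleftrightarrow> P j \<and> P k \<and> P l" for P
      by metis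
    define f where "f = (\<lambda>_. [])(j := p, k := q, l := r)"
    have f: "f j = p" "f k = q" "f l = r" using jkl(2-4) by (auto simp: f_def)
    have "\<forall>x<4. x \<noteq> i \<longrightarrow> is_path E (f x) \<and> f x \<noteq> [] \<and> hd (f x) = w \<and> last (f x) = a i x
      \<and> set (f x) \<subseteq> X i \<and> (\<forall>y<4. y \<noteq> i \<longrightarrow> y \<noteq> x \<longrightarrow> set (f x) \<inter> set (f y) = {w})"
      unfolding eq f using t jkl(2-4) by (simp add: Int_commute)
    then show ?thesis by blast
  qed
  then have "\<forall>i. \<exists>w q. i < 4 \<longrightarrow> (\<forall>j<4. j \<noteq> i \<longrightarrow> is_path E (q j) \<and> q j \<noteq> [] \<and> hd (q j) = w \<and> last (q j) = a i j
      \<and> set (q j) \<subseteq> X i \<and> (\<forall>k<4. k \<noteq> i \<longrightarrow> k \<noteq> j \<longrightarrow> set (q j) \<inter> set (q k) = {w}))" by blast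
  then obtain b q where bq0: "\<forall>i<4. \<forall>j<4. j \<noteq> i \<longrightarrow>
      is_path E (q i j) \<and> q i j \<noteq> [] \<and> hd (q i j) = b i \<and> last (q i j) = a i j \<and> set (q i j) \<subseteq> X i \<and>
      (\<forall>k<4. k \<noteq> i \<longrightarrow> k \<noteq> j \<longrightarrow> set (q i j) \<inter> set (q i k) = {b i})"
    unfolding choice_iff by blast
  then have bq: "\<And>i j. i < 4 \<Longrightarrow> j < 4 \<Longrightarrow> j \<noteq> i \<Longrightarrow>
      is_path E (q i j) \<and> q i j \<noteq> [] \<and> hd (q i j) = b i \<and> last (q i j) = a i j \<and> set (q i j) \<subseteq> X i"
    and bq2: "\<And>i j k. i < 4 \<Longrightarrow> j < 4 \<Longrightarrow> j \<noteq> i \<Longrightarrow> k < 4 \<Longrightarrow> k \<noteq> i \<Longrightarrow> k \<noteq> j \<Longrightarrow>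
      set (q i j) \<inter> set (q i k) = {b i}"
    by simp_all
  have bX: "b i \<in> X i" if "i < 4" for i
  proof -
    have "(if i = 0 then 1 else 0) < (4::nat)" "(if i = 0 then 1 else 0) \<noteq> i" by auto
    then obtain j :: nat where j: "j < 4" "j \<noteq> i" by blast
    show ?thesis using bq[OF that j] hd_in_set[of "q i j"] by auto
  qed
  have bXD: "i = j" if "b i \<in> X j" "i < 4" "j < 4" for i j
    using dis'[of i j] bX[of i] that by blast
  define p where "p i j = q i j @ rev (q j i)" for i j
  have inj: "inj_on b {..<4}" using bX bXD by (intro inj_onI) (metis lessThan_iff)
  have bV: "b ` {..<4} \<subseteq> V" using bX sub by blast
  have paths: "is_path E (p i j) \<and> length (p i j) \<ge> 2 \<and> hd (p i j) = b i \<and> last (p i j) = b j \<and>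
      set (p i j) \<inter> b ` {..<4} = {b i, b j}" if ij: "i < j" "j < 4" for i j
  proof -
    have A: "i < 4" "i \<noteq> j" using ij by auto
    note Q = bq[OF A(1) ij(2)] bq[OF ij(2) A(1)]
    have "is_path E (p i j)"
      using Q A ij aE[of i j] dis'[of i j] unfolding p_def is_path_def
      by (auto simp: successively_append_iff successively_adj_rev hd_rev simp del: successively_rev)
    moreover have "length (p i j) \<ge> 2" 
    proof -
      have "length (q i j) \<ge> 1" "length (q j i) \<ge> 1" using Q A by (auto simp: Suc_le_eq)
      then show ?thesis by (simp add: p_def)
    qed
    moreover have "hd (p i j) = b i" "last (p i j) = b j"
      using Q A by (auto simp: p_def last_rev)
    moreover have "set (p i j) \<inter> b ` {..<4} \<subseteq> {b i, b j}"
    proof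
      fix x assume "x \<in> set (p i j) \<inter> b ` {..<4}"
      then obtain k where k: "x = b k" "k < 4" "b k \<in> X i \<or> b k \<in> X j"
        using Q A by (auto simp: p_def)
      then show "x \<in> {b i, b j}" using bXD A ij by blast
    qed
    moreover have "b i \<in> set (p i j)" "b j \<in> set (p i j)"
      using hd_in_set[of "q i j"] hd_in_set[of "q j i"] Q A by (auto simp: p_def)
    ultimately show ?thesis using A ij by auto
  qed
  have inter: "set (p i j) \<inter> set (p k l) \<subseteq> b ` {..<4}"
    if "i < j" "j < 4" "k < l" "l < 4" "(i, j) \<noteq> (k, l)" for i j k l
  proof
    fix x assume x: "x \<in> set (p i j) \<inter> set (p k l)"
    have lt: "i < 4" "k < 4" using that by auto
    have key: "x \<in> b ` {..<4}" if "x \<in> set (q m n)" "x \<in> set (q m' n')" "m < 4" "n < 4" "m \<noteq> n" "m' < 4" "n' < 4"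
      "m' \<noteq> n'" "(m, n) \<noteq> (m', n')" for m n m' n'
    proof -
      have x: "x \<in> X m" "x \<in> X m'" using that bq[of m n] bq[of m' n'] by auto
      have m: "m = m'" using dis'[OF _ that(3,6)] x by blast
      have "set (q m n) \<inter> set (q m n') = {b m}" by (rule bq2) (use that m in auto)
      then have "x = b m" using that(1,2) m by blast
      then show ?thesis using that(3) by blast
    qed
    consider "x \<in> set (q i j)" "x \<in> set (q k l)" | "x \<in> set (q i j)" "x \<in> set (q l k)"
      | "x \<in> set (q j i)" "x \<in> set (q k l)" | "x \<in> set (q j i)" "x \<in> set (q l k)"
      using x unfolding p_def by auto
    then show "x \<in> b ` {..<4}"
    proof cases
      case 1 then show ?thesis by (rule key) (use that lt in auto)
    next
      case 2 then show ?thesis by (rule key) (use that lt in auto)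
    next
      case 3 then show ?thesis by (rule key) (use that lt in auto)
    next
      case 4 then show ?thesis by (rule key) (use that lt in auto)
    qed
  qed
  show ?thesis unfolding has_K4_subdivision_def
    by (intro exI[of _ b] exI[of _ p] conjI allI impI inj bV) (use paths inter in blast)+
qed

end

subsection \<open>Components of separation pairs\<close>

context sgraph
begin

text \<open>A union of components of the graph minus \<open>u\<close> and \<open>v\<close>, possibly
  none or all of them. Connectedness is kept separate because the constructions peel off one
  component at a time and need the remainder to be of the same kind.\<close>

definition comp_union :: "'a \<Rightarrow> 'a \<Rightarrow> 'a set \<Rightarrow> bool" where
  "comp_union u v C \<longleftrightarrow> u \<in> V \<and> v \<in> V \<and> u \<noteq> v \<and> C \<subseteq> V - {u, v} \<and>
     (\<forall>x\<in>C. \<forall>y\<in>V - {u, v}. E x y \<longrightarrow> y \<in> C)"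

lemma comp_union_sym: "comp_union u v C \<Longrightarrow> comp_union v u C"
  by (auto simp: comp_union_def)

lemma comp_union_nbr: "comp_union u v C \<Longrightarrow> x \<in> C \<Longrightarrow> E x y \<Longrightarrow> y \<in> C \<or> y = u \<or> y = v"
  using adjV by (auto simp: comp_union_def)

lemma comp_union_notin: "comp_union u v C \<Longrightarrow> u \<notin> C \<and> v \<notin> C"
  by (auto simp: comp_union_def)

lemma component_iff:
  "s \<in> V \<Longrightarrow> t \<in> V \<Longrightarrow> s \<noteq> t \<Longrightarrow>
    C \<in> components_of E (V - {s, t}) \<longleftrightarrow> comp_union s t C \<and> C \<noteq> {} \<and> connected_on E C"
  by (auto simp: components_of_iff comp_union_def)

lemma comp_union_component:
  assumes "comp_union u v C" "K \<in> components_of E C"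
  shows "comp_union u v K"
  using assms unfolding comp_union_def components_of_iff by blast

lemma comp_union_Diff:
  assumes "comp_union u v C" "comp_union u v K"
  shows "comp_union u v (C - K)"
  using assms adj_sym unfolding comp_union_def by blast

lemma no_K4_minor:
  assumes nK: "\<not> has_K4_subdivision V E"
    and con: "connected_on E X0" "connected_on E X1" "connected_on E X2" "connected_on E X3"
    and sub: "X0 \<union> X1 \<union> X2 \<union> X3 \<subseteq> V"
    and dis: "X0 \<inter> X1 = {}" "X0 \<inter> X2 = {}" "X0 \<inter> X3 = {}" "X1 \<inter> X2 = {}" "X1 \<inter> X3 = {}" "X2 \<inter> X3 = {}"
    and adj: "\<exists>x\<in>X0. \<exists>y\<in>X1. E x y" "\<exists>x\<in>X0. \<exists>y\<in>X2. E x y" "\<exists>x\<in>X0. \<exists>y\<in>X3. E x y"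
      "\<exists>x\<in>X1. \<exists>y\<in>X2. E x y" "\<exists>x\<in>X1. \<exists>y\<in>X3. E x y" "\<exists>x\<in>X2. \<exists>y\<in>X3. E x y"
  shows False
proof -
  define X where "X i = (if i = 0 then X0 else if i = 1 then X1 else if i = 2 then X2 else X3)" for i :: nat
  have X: "X 0 = X0" "X (Suc 0) = X1" "X 2 = X2" "X 3 = X3" by (auto simp: X_def)
  have lt4: "i = 0 \<or> i = Suc 0 \<or> i = 2 \<or> i = 3" if "i < 4" for i :: nat using that by auto
  have pair: "(i = 0 \<and> j = Suc 0) \<or> (i = 0 \<and> j = 2) \<or> (i = 0 \<and> j = 3) \<or> (i = Suc 0 \<and> j = 2)
     \<or> (i = Suc 0 \<and> j = 3) \<or> (i = 2 \<and> j = 3)" if "i < j" "j < 4" for i j :: nat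
    using that by auto
  have "has_K4_subdivision V E"
  proof (rule K4_minor_imp_subdivision[of X])
    show "connected_on E (X i)" if "i < 4" for i using lt4[OF that] con by (elim disjE) (simp_all add: X)
    show "X i \<subseteq> V" if "i < 4" for i using lt4[OF that] sub by (elim disjE) (simp_all add: X)
    show "X i \<inter> X j = {}" if "i < j" "j < 4" for i j
      using pair[OF that] dis by (elim disjE) (simp_all add: X)
    show "\<exists>x\<in>X i. \<exists>y\<in>X j. E x y" if "i < j" "j < 4" for i j
      using pair[OF that] adj by (elim disjE) (simp_all add: X)
  qed
  then show False using nK by blast
qed

end

section \<open>Consequences of biconnectivity\<close>

locale biconnected_graph = sgraph +
  assumes biconn: "biconnected V E"
begin

lemma connected_minus: "v \<in> V \<Longrightarrow> connected_on E (V - {v})"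
  using biconn by (simp add: biconnected_def)

text \<open>Otherwise \<open>v\<close> alone would cut \<open>C\<close> off from
  \<open>u\<close>.\<close>

lemma comp_union_attach:
  assumes "comp_union u v C" "C \<noteq> {}"
  shows "\<exists>x\<in>C. E u x"
proof -
  obtain c where c: "c \<in> C" using assms by blast
  have *: "v \<in> V" "C \<subseteq> V - {v}" "u \<in> V - {v}" "u \<notin> C" using assms(1) by (auto simp: comp_union_def)
  then obtain a b where ab: "a \<in> C" "b \<in> V - {v}" "b \<notin> C" "E a b"
    using connected_on_cutD[OF connected_minus[OF *(1)] *(2) c *(3,4)] by blast
  then have "b = u" using comp_union_nbr[OF assms(1) ab(1,4)] by blast
  then show ?thesis using ab adj_sym[OF ab(4)] by blast
qed

lemma comp_union_separation_pair:
  assumes "comp_union u v C" "C \<noteq> {}" "V - {u, v} - C \<noteq> {}"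
  shows "separation_pair V E u v"
proof -
  have "\<not> connected_on E (V - {u, v})"
    using connected_on_closed_eq[of E "V - {u, v}" C] assms by (auto simp: comp_union_def)
  then show ?thesis using assms by (auto simp: separation_pair_def comp_union_def)
qed

text \<open>In the graph minus \<open>u\<close>, a set outside \<open>C\<close> that misses
  \<open>v\<close> is left by some edge, and this edge cannot enter \<open>C\<close>, whose only
  outside neighbours are \<open>u\<close> and \<open>v\<close>. In minors the result supplies the
  branch set for everything beyond a component.\<close>

lemma connected_outside:
  assumes C: "comp_union u v C"
  shows "connected_on E (V - C - {u})"
  unfolding connected_on_cut
proof (intro allI impI)
  fix X assume X: "X \<subseteq> V - C - {u}" "X \<noteq> {}" "X \<noteq> V - C - {u}"
  define Y where "Y = (if v \<in> X then (V - C - {u}) - X else X)"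
  have Y: "Y \<subseteq> V - {u}" "Y \<noteq> {}" "v \<notin> Y" "Y \<inter> C = {}" using X by (auto simp: Y_def)
  have uv: "u \<in> V" "v \<in> V" "u \<noteq> v" using C by (auto simp: comp_union_def)
  obtain c where "c \<in> Y" using Y by blast
  then obtain a b where ab: "a \<in> Y" "b \<in> V - {u}" "b \<notin> Y" "E a b"
    using connected_on_cutD[OF connected_minus[of u], of Y c v] Y uv by auto
  have "b \<notin> C" using comp_union_nbr[OF C, of b a] ab Y adj_sym by blast
  then show "\<exists>x\<in>X. \<exists>y\<in>V - C - {u} - X. E x y"
    using ab X adj_sym[of a b] by (cases "v \<in> X") (auto simp: Y_def)
qed

end

section \<open>Splitting a component at a vertex\<close>

locale sp_graph = biconnected_graph +
  assumes K4_free: "\<not> has_K4_subdivision V E"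
    and ntrans: "no_transitive_edges V E"
begin

text \<open>The form in which the absence of transitive edges acts on separators: once the part
  between \<open>u\<close> and a separator \<open>d\<close> is nonempty, \<open>d\<close> is not
  adjacent to \<open>u\<close>.\<close>

lemma comp_union_not_adj:
  assumes "comp_union u v C" "C \<noteq> {}" "V - {u, v} - C \<noteq> {}"
  shows "\<not> E u v"
  using comp_union_separation_pair[OF assms] ntrans by (auto simp: no_transitive_edges_def)

text \<open>The only use of \<open>K\<^sub>4\<close>-freeness. On a path \<open>p\<close> through \<open>C\<close> from \<open>N(u)\<close> to \<open>N(v)\<close>, let \<open>d\<close> be the last
  vertex adjacent to \<open>u\<close> or to the part \<open>K\<close> of \<open>C - p\<close> attached to \<open>u\<close>. A connection bypassing \<open>d\<close> would start
  before \<open>d\<close> on \<open>p\<close>, and \<open>{u} \<union> K\<close>, the two parts of \<open>p\<close> up to \<open>d\<close>, and the rest would form a \<open>K\<^sub>4\<close> minor.\<close>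

lemma separator:
  assumes C: "comp_union u v C" "C \<noteq> {}" "connected_on E C"
    and out: "V - {u, v} - C \<noteq> {} \<or> E u v"
  obtains d D1 D2 where "C = insert d (D1 \<union> D2)" "d \<notin> D1" "d \<notin> D2" "D1 \<inter> D2 = {}"
    "comp_union u d D1" "comp_union d v D2"
proof -
  have uv: "u \<in> V" "v \<in> V" "u \<noteq> v" and CV: "C \<subseteq> V" "u \<notin> C" "v \<notin> C" using C by (auto simp: comp_union_def)
  \<comment> \<open>\<open>R\<close> is the branch set for the outside: it contains
    \<open>v\<close>, and by \<open>out\<close> it is adjacent to \<open>u\<close>, through the edge
    from \<open>u\<close> to \<open>v\<close> or through another component.\<close>
  define R where "R = V - C - {u}"
  have R: "connected_on E R" "v \<in> R" "R \<inter> C = {}" "u \<notin> R" "R \<subseteq> V"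
    using connected_outside[OF C(1)] uv CV by (auto simp: R_def)
  have uR: "\<exists>x\<in>{u}. \<exists>y\<in>R. E x y"
  proof (cases "E u v")
    case True
    then show ?thesis using R by blast
  next
    case False
    have "comp_union u v (V - {u, v} - C)"
      using C(1) adj_sym unfolding comp_union_def by blast
    from comp_union_attach[OF this] out False obtain x where "x \<in> V - {u, v} - C" "E u x" by blast
    then show ?thesis by (auto simp: R_def)
  qed
  obtain a b where a: "a \<in> C" "E u a" and b: "b \<in> C" "E v b"
    using comp_union_attach[OF C(1,2)] comp_union_attach[OF comp_union_sym[OF C(1)] C(2)] by blast
  obtain p0 where p0: "is_path E p0" "p0 \<noteq> []" "hd p0 = a" "last p0 = b" "set p0 \<subseteq> C"
    using connected_on_path[OF C(3) a(1) b(1)] by blast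
  have "\<exists>x\<in>set p0. E v x" using p0 b by (metis last_in_set)
  then obtain q y q' where q: "p0 = q @ y # q'" "E v y" "\<forall>x\<in>set q. \<not> E v x"
    using split_list_first_prop[of p0 "E v"] by blast
  define p where "p = q @ [y]"
  have p: "successively E p" "distinct p" "p \<noteq> []" "hd p = a" "set p \<subseteq> C" "E v (last p)"
    "\<forall>x\<in>set (butlast p). \<not> E v x"
    using p0 q by (auto simp: p_def is_path_def successively_append_iff hd_append)
  define S where "S = C - set p"
  define K where "K = \<Union>{Q \<in> components_of E S. \<exists>x\<in>Q. E u x}"
  have KS: "K \<subseteq> S" by (auto simp: K_def components_of_iff)
  have closedS: "z \<in> Q" if "Q \<in> components_of E S" "x \<in> Q" "z \<in> S" "E x z" for Q x z
    using that unfolding components_of_iff by blast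
  have uK: "x \<in> K" if x: "x \<in> S" "E u x" for x
  proof -
    obtain Q where "Q \<in> components_of E S" "x \<in> Q" using component_exists[OF x(1)] by blast
    then show ?thesis using x(2) by (auto simp: K_def)
  qed
  have Kcl: "y \<in> K" if "x \<in> K" "y \<in> S" "E x y" for x y
    using that unfolding K_def by (blast dest: closedS)
  have conK: "connected_on E (insert u K)"
    unfolding connected_on_cut
  proof (intro allI impI)
    fix X assume X: "X \<subseteq> insert u K" "X \<noteq> {}" "X \<noteq> insert u K"
    define Y where "Y = (if u \<in> X then insert u K - X else X)"
    have Y: "Y \<subseteq> K" "Y \<noteq> {}" using X by (auto simp: Y_def)
    then obtain z where z: "z \<in> Y" "z \<in> K" by blast
    then obtain Q where Q: "Q \<in> components_of E S" "\<exists>x\<in>Q. E u x" "z \<in> Q" unfolding K_def by blast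
    have "\<exists>x\<in>Y. \<exists>y\<in>insert u K - Y. E x y"
    proof (cases "Q \<subseteq> Y")
      case True
      moreover have "u \<notin> K" using CV KS by (auto simp: S_def)
      ultimately show ?thesis using Q(2) Y adj_sym by blast
    next
      case False
      then obtain z' where z': "z' \<in> Q" "z' \<notin> Y" by blast
      have "connected_on E Q" using Q by (simp add: components_of_iff)
      then have "\<exists>x\<in>Y \<inter> Q. \<exists>y\<in>Q - Y \<inter> Q. E x y"
        by (rule connected_on_cutD[of _ _ _ z z']) (use z z' Q in auto)
      then obtain x y where "x \<in> Y" "y \<in> Q" "y \<notin> Y" "E x y" by blast
      moreover have "y \<in> K" using \<open>y \<in> Q\<close> Q(1,2) unfolding K_def by blast
      ultimately show ?thesis by blast
    qed
    then obtain x y where xy: "x \<in> Y" "y \<in> insert u K - Y" "E x y" by blast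
    show "\<exists>x\<in>X. \<exists>y\<in>insert u K - X. E x y"
      using xy X adj_sym[of x y] by (cases "u \<in> X") (auto simp: Y_def)
  qed
  \<comment> \<open>A component \<open>Q\<close> of \<open>S\<close> adjacent to both
    \<open>u\<close> and \<open>v\<close> would give the minor with branch sets \<open>{u}\<close>,
    \<open>set p\<close>, \<open>Q\<close>, \<open>R\<close>; \<open>Q\<close> is adjacent to
    \<open>p\<close> because \<open>C\<close> is connected.\<close>
  have Kv: "\<not> E v x" if xK: "x \<in> K" for x
  proof
    assume vx: "E v x"
    obtain Q where Q: "Q \<in> components_of E S" "x \<in> Q" "\<exists>x\<in>Q. E u x" using xK unfolding K_def by blast
    have Q': "Q \<subseteq> S" "connected_on E Q" "\<And>x y. x \<in> Q \<Longrightarrow> y \<in> S \<Longrightarrow> E x y \<Longrightarrow> y \<in> Q"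
      using Q(1) unfolding components_of_iff by blast+
    have ap: "a \<in> set p" using hd_in_set[OF p(3)] p(4) by simp
    have QC: "Q \<subseteq> C" "Q \<inter> set p = {}" using Q'(1) by (auto simp: S_def)
    have "\<exists>y\<in>Q. \<exists>z\<in>C - Q. E y z"
      by (rule connected_on_cutD[OF C(3) QC(1) Q(2) a(1)]) (use QC ap in blast)
    then obtain y z where yz: "y \<in> Q" "z \<in> C" "z \<notin> Q" "E y z" by blast
    then have "z \<in> set p" using Q'(3)[OF yz(1) _ yz(4)] by (auto simp: S_def)
    show False
    proof (rule no_K4_minor[OF K4_free, of "{u}" "set p" Q R])
      show "connected_on E (set p)" using p(1) by (rule connected_on_set_path)
      show "\<exists>x\<in>{u}. \<exists>y\<in>set p. E x y" using a ap by blast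
      show "\<exists>x\<in>set p. \<exists>y\<in>Q. E x y" using yz(1) adj_sym[OF yz(4)] \<open>z \<in> set p\<close> by blast
      show "\<exists>x\<in>set p. \<exists>y\<in>R. E x y" using last_in_set[OF p(3)] adj_sym[OF p(6)] R(2) by blast
      show "\<exists>x\<in>Q. \<exists>y\<in>R. E x y" using Q(2) R(2) adj_sym[OF vx] by blast
    qed (use Q(3) Q'(2) QC R uR p(5) CV uv in auto)
  qed
  have "\<exists>x\<in>set p. E u x \<or> (\<exists>k\<in>K. E k x)" using hd_in_set[OF p(3)] p(4) a(2) by auto
  then obtain P1 d P2 where P: "p = P1 @ d # P2" and d: "E u d \<or> (\<exists>k\<in>K. E k d)"
    and P2: "\<forall>x\<in>set P2. \<not> (E u x \<or> (\<exists>k\<in>K. E k x))"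
    using split_list_last_prop[of p "\<lambda>x. E u x \<or> (\<exists>k\<in>K. E k x)"] by blast
  \<comment> \<open>\<open>K\<close>, \<open>W\<close> and \<open>P1\<close> together form the side
    of \<open>u\<close>; the components of \<open>S\<close> left out touch \<open>p\<close> only
    from \<open>d\<close> on.\<close>
  define W where "W = \<Union>{Q \<in> components_of E S. \<exists>x\<in>Q. \<exists>y\<in>set P1. E x y}"
  define D where "D = K \<union> W \<union> set P1"
  have WS: "W \<subseteq> S" by (auto simp: W_def components_of_iff)
  \<comment> \<open>A jump from \<open>x\<close> before \<open>d\<close> to \<open>v\<close> or
    beyond \<open>d\<close>, by an edge (with \<open>W'\<close> possibly empty) or through a
    connected \<open>W'\<close> avoiding \<open>K\<close>. The branch sets are
    \<open>insert u K\<close>, the piece \<open>A\<close> of \<open>p\<close> up to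
    \<open>x\<close>, the piece \<open>B\<close> from there up to \<open>d\<close>, and
    \<open>X\<close>.\<close>
  have no_jump: False if x: "x \<in> set P1" and W': "connected_on E W'" "W' \<subseteq> S" "W' \<inter> K = {}"
    and y: "y \<in> insert v (set P2)" and xy: "E x y \<or> (\<exists>w\<in>W'. E x w) \<and> (\<exists>w\<in>W'. E w y)" for x y W'
  proof -
    obtain P1a P1b where P1: "P1 = P1a @ x # P1b" using x by (auto simp: in_set_conv_decomp)
    define RP where "RP = R \<union> set P2"
    have RP: "connected_on E RP" 
    proof (cases "P2 = []")
      case False
      have "connected_on E (set P2)"
        by (rule connected_on_set_path) (use p in \<open>auto simp: P successively_append_iff successively_Cons\<close>)
      then show ?thesis unfolding RP_def
        using connected_on_Un[OF R(1) _ R(2), of "set P2" "last P2"] False p by (auto simp: P)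
    qed (use R in \<open>simp add: RP_def\<close>)
    have yRP: "y \<in> RP" using y R by (auto simp: RP_def)
    \<comment> \<open>\<open>W'\<close> joins the last branch set only if there is no direct edge,
      since with one it need not be attached to \<open>RP\<close>.\<close>
    define X where "X = (if E x y then RP else RP \<union> W')"
    have X: "connected_on E X"
      using connected_on_Un[OF W'(1) RP, of _ y] yRP xy RP by (auto simp: X_def Un_commute)
    have Xsub: "X \<subseteq> R \<union> set P2 \<union> W'" "R \<subseteq> X" "RP \<subseteq> X" by (auto simp: X_def RP_def)
    have XE: "\<exists>w\<in>X. E x w" using xy yRP by (auto simp: X_def)
    define A B where "A = set (P1a @ [x])" and "B = set (P1b @ [d])"
    have AB: "A \<union> B \<union> set P2 \<subseteq> set p" "A \<inter> B = {}" "A \<inter> set P2 = {}" "B \<inter> set P2 = {}"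
      using p(2) by (auto simp: P P1 A_def B_def)
    have AC: "A \<union> B \<union> set P2 \<subseteq> C" using AB(1) p(5) by blast
    have S: "S \<inter> set p = {}" "S \<subseteq> C" by (auto simp: S_def)
    have dis: "X \<inter> A = {}" "X \<inter> B = {}" using Xsub(1) R(3) AB AC S(1) W'(2) by blast+
    have KC: "K \<subseteq> C" "K \<inter> set p = {}" using KS S by blast+
    have XC: "X \<subseteq> R \<union> C" using Xsub(1) AC S(2) W'(2) by blast
    have "K \<inter> set P2 = {}" using KC(2) AB(1) by blast
    then have disu: "u \<notin> X" "X \<inter> K = {}" "insert u K \<inter> A = {}" "insert u K \<inter> B = {}"
      subgoal using XC R(4) CV(2) by blast
      subgoal using Xsub(1) R(3) KC(1) W'(3) \<open>K \<inter> set P2 = {}\<close> by blast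
      subgoal using KC(2) AB(1) AC CV(2) by blast
      subgoal using KC(2) AB(1) AC CV(2) by blast
      done
    have "insert u K \<subseteq> V" "A \<union> B \<subseteq> V" "X \<subseteq> V" using KC(1) AC XC CV(1) uv(1) R(5) by blast+
    then have sub: "insert u K \<union> A \<union> B \<union> X \<subseteq> V" by blast
    have s: "successively E ((P1a @ [x]) @ (P1b @ [d]) @ P2)" using p(1) by (simp add: P P1)
    show False
    proof (rule no_K4_minor[OF K4_free, of "insert u K" A B X])
      have "successively E (P1a @ [x])" "successively E (P1b @ [d])"
        using s unfolding successively_append_iff by blast+
      then show "connected_on E A" "connected_on E B"
        unfolding A_def B_def by (blast intro: connected_on_set_path)+
      have "hd p \<in> A" by (cases P1a) (auto simp: P P1 A_def)
      then show "\<exists>x\<in>insert u K. \<exists>y\<in>A. E x y" using p(4) a(2) by auto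
      show "\<exists>x\<in>insert u K. \<exists>y\<in>B. E x y" using d by (auto simp: B_def)
      show "\<exists>x\<in>insert u K. \<exists>y\<in>X. E x y" using uR Xsub(2) by blast
      have "E x (hd (P1b @ [d]))" using s unfolding successively_append_iff by (cases P1b) auto
      then show "\<exists>x\<in>A. \<exists>y\<in>B. E x y"
        using hd_in_set[of "P1b @ [d]"] by (auto simp: A_def B_def)
      show "\<exists>x\<in>A. \<exists>y\<in>X. E x y" using XE by (auto simp: A_def)
      have "\<exists>y\<in>RP. E d y"
      proof (cases "P2 = []")
        case True
        then show ?thesis using p(6) R(2) adj_sym[of v d] by (auto simp: P RP_def)
      next
        case False
        then have "E d (hd P2)" using s unfolding successively_append_iff by simp
        then show ?thesis using False by (auto simp: RP_def)
      qed
      then show "\<exists>x\<in>B. \<exists>y\<in>X. E x y" using Xsub(3) by (auto simp: B_def)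
    qed (use X conK sub dis disu AB(2) in blast)+
  qed
  have DC: "D \<subseteq> C" "d \<notin> D" and dC: "d \<in> C"
    using KS WS p(2,5) by (auto simp: D_def S_def P)
  have Kp: "z \<in> K \<or> z \<in> set P1 \<or> z = d" if "x \<in> K" "z \<in> C" "E x z" for x z
    using that Kcl[of x z] P2 by (auto simp: S_def P)
  have WK: "Q \<inter> K = {}" if "Q \<in> components_of E S" "\<not> Q \<subseteq> K" for Q
    using that(2) components_disjoint[OF that(1)] unfolding K_def by blast
  have Wjump: False if xW: "x \<in> W" "x \<notin> K" "y \<in> insert v (set P2)" "E x y" for x y
  proof -
    obtain Q w z where Q: "Q \<in> components_of E S" "x \<in> Q" "w \<in> Q" "z \<in> set P1" "E w z"
      using xW unfolding W_def by blast
    have "connected_on E Q" "Q \<subseteq> S" using Q(1) by (simp_all add: components_of_iff)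
    moreover have "Q \<inter> K = {}" using WK[OF Q(1)] Q(2) xW(2) by blast
    moreover have "(\<exists>w\<in>Q. E z w) \<and> (\<exists>w\<in>Q. E w y)" using Q(2,3) adj_sym[OF Q(5)] xW(4) by blast
    ultimately show False using no_jump[OF Q(4) _ _ _ xW(3)] by blast
  qed
  have Pjump: False if "x \<in> set P1" "y \<in> insert v (set P2)" "E x y" for x y
    using no_jump[OF that(1) _ _ _ that(2), of "{}"] that(3) by (simp add: connected_on_def)
  have Wcl: "z \<in> W" if "x \<in> W" "z \<in> S" "E x z" for x z
    using that unfolding W_def by (blast dest: closedS)
  have PW: "z \<in> W" if x: "x \<in> set P1" "z \<in> S" "E x z" for x z
  proof -
    obtain Q where "Q \<in> components_of E S" "z \<in> Q" using component_exists[OF x(2)] by blast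
    then show ?thesis using x(1) adj_sym[OF x(3)] by (auto simp: W_def)
  qed
  have Dcl: "z \<in> D" if xz: "x \<in> D" "z \<in> C - {d}" "E x z" for x z
  proof (cases "x \<in> K")
    case True
    then show ?thesis using Kp[of x z] xz by (auto simp: D_def)
  next
    case False
    then have x: "x \<in> W \<or> x \<in> set P1" using xz(1) by (auto simp: D_def)
    then have "z \<notin> set P2" using Wjump[of x z] Pjump[of x z] xz(3) False by blast
    then have z: "z \<in> S \<or> z \<in> set P1" using xz(2) by (auto simp: S_def P)
    have "z \<in> W" if "z \<in> S" using x Wcl[OF _ that xz(3)] PW[OF _ that xz(3)] by blast
    then show ?thesis using z unfolding D_def by blast
  qed
  have Dv: "\<not> E x v" if "x \<in> D" for x
    using that Wjump[of x v] Pjump[of x v] Kv[of x] adj_sym[of x v] by (auto simp: D_def)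
  have Du: "x \<in> D" if "x \<in> C" "x \<noteq> d" "E x u" for x
    using that uK[of x] P2 adj_sym[of x u] by (auto simp: D_def S_def P)
  show thesis
  proof (rule that[of d D "C - {d} - D"])
    show "comp_union u d D"
      unfolding comp_union_def using DC dC CV uv Dcl Dv comp_union_nbr[OF C(1)] by blast
    show "comp_union d v (C - {d} - D)"
      unfolding comp_union_def
    proof (intro conjI ballI impI)
      fix x y assume xy: "x \<in> C - {d} - D" "y \<in> V - {d, v}" "E x y"
      have "y \<noteq> u" using Du xy by blast
      then have "y \<in> C" using comp_union_nbr[OF C(1), of x y] xy by blast
      moreover have "y \<notin> D" using Dcl[of y x] xy adj_sym by blast
      ultimately show "y \<in> C - {d} - D" using xy by blast
    qed (use DC dC CV uv in blast)+
  qed (use DC dC in auto)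
qed

end

subsection \<open>Insertion sequences\<close>

context sgraph
begin

text \<open>Grounded L-shapes are encoded by insertion sequences: the list holds the anchors from left to right,
  and vertices are inserted from the deepest to the shallowest horizontal segment. The horizontal
  segment of \<open>w\<close> meets exactly the deeper curves whose anchors lie over it, so the neighbours already present
  must form a block \<open>q\<close> starting right next to \<open>w\<close>.\<close>

inductive ins :: "'a list \<Rightarrow> 'a list \<Rightarrow> bool" where
  ins_before: "w \<notin> set (p @ q @ r) \<Longrightarrow> \<forall>x\<in>set (p @ q @ r). E w x \<longleftrightarrow> x \<in> set q \<Longrightarrow>
     ins (p @ q @ r) (p @ w # q @ r)"
| ins_after: "w \<notin> set (p @ q @ r) \<Longrightarrow> \<forall>x\<in>set (p @ q @ r). E w x \<longleftrightarrow> x \<in> set q \<Longrightarrow>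
     ins (p @ q @ r) (p @ q @ w # r)"

lemma ins_set: "ins L L' \<Longrightarrow> set L \<subseteq> set L'"
  by (induction rule: ins.induct) auto

lemma ins_rtrancl_set: "ins\<^sup>*\<^sup>* L L' \<Longrightarrow> set L \<subseteq> set L'"
  by (induction rule: rtranclp_induct) (auto dest: ins_set)

lemma ins_rev: "ins L L' \<Longrightarrow> ins (rev L) (rev L')"
proof (induction rule: ins.induct)
  case (ins_before w p q r)
  then show ?case using ins_after[of w "rev r" "rev q" "rev p"] by auto
next
  case (ins_after w p q r)
  then show ?case using ins_before[of w "rev r" "rev q" "rev p"] by auto
qed

lemma ins_rtrancl_rev: "ins\<^sup>*\<^sup>* L L' \<Longrightarrow> ins\<^sup>*\<^sup>* (rev L) (rev L')"
  by (induction rule: rtranclp_induct) (auto dest: ins_rev intro: rtranclp.rtrancl_into_rtrancl)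

text \<open>Surrounding vertices are non-neighbours of the inserted vertex, so its block remains a
  block. Parts attached to different pairs can thus be built separately and placed into a common
  list.\<close>

lemma ins_context:
  assumes "ins L L'" "\<And>w. w \<in> set L' \<Longrightarrow> w \<notin> set L \<Longrightarrow> w \<notin> set xs \<union> set ys \<and> (\<forall>x\<in>set xs \<union> set ys. \<not> E w x)"
    and "set L \<inter> (set xs \<union> set ys) = {}"
  shows "ins (xs @ L @ ys) (xs @ L' @ ys)"
  using assms
proof (induction rule: ins.induct)
  case (ins_before w p q r)
  have w: "w \<notin> set xs \<union> set ys \<and> (\<forall>x\<in>set xs \<union> set ys. \<not> E w x)"
    by (rule ins_before(3)) (use ins_before(1) in auto)
  have "ins ((xs @ p) @ q @ (r @ ys)) ((xs @ p) @ w # q @ (r @ ys))"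
    by (rule ins.ins_before) (use w ins_before(1,2,4) in auto)
  then show ?case by simp
next
  case (ins_after w p q r)
  have w: "w \<notin> set xs \<union> set ys \<and> (\<forall>x\<in>set xs \<union> set ys. \<not> E w x)"
    by (rule ins_after(3)) (use ins_after(1) in auto)
  have "ins ((xs @ p) @ q @ (r @ ys)) ((xs @ p) @ q @ w # (r @ ys))"
    by (rule ins.ins_after) (use w ins_after(1,2,4) in auto)
  then show ?case by simp
qed

lemma ins_rtrancl_context:
  assumes "ins\<^sup>*\<^sup>* L L'" "\<And>w. w \<in> set L' \<Longrightarrow> w \<notin> set L \<Longrightarrow> w \<notin> set xs \<union> set ys \<and> (\<forall>x\<in>set xs \<union> set ys. \<not> E w x)"
    and "set L \<inter> (set xs \<union> set ys) = {}"
  shows "ins\<^sup>*\<^sup>* (xs @ L @ ys) (xs @ L' @ ys)"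
  using assms
proof (induction rule: rtranclp_induct)
  case (step M M')
  have sub: "set L \<subseteq> set M" "set M \<subseteq> set M'" using step(1,2) ins_rtrancl_set ins_set by blast+
  have "ins\<^sup>*\<^sup>* (xs @ L @ ys) (xs @ M @ ys)"
    by (rule step.IH) (use step.prems sub in blast)+
  moreover have "ins (xs @ M @ ys) (xs @ M' @ ys)"
    by (rule ins_context[OF step(2)]) (use step.prems sub in blast)+
  ultimately show ?case by (rule rtranclp.rtrancl_into_rtrancl)
qed simp

text \<open>Each new vertex goes directly in front of \<open>L\<close>, behind the part of
  \<open>xs\<close> already present, so its block is exactly \<open>L\<close>.\<close>

lemma ins_many_before:
  assumes "distinct xs" "set xs \<inter> set L = {}" "\<And>x y. x \<in> set xs \<Longrightarrow> y \<in> set xs \<Longrightarrow> \<not> E x y"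
    "\<And>x y. x \<in> set xs \<Longrightarrow> y \<in> set L \<Longrightarrow> E x y"
  shows "ins\<^sup>*\<^sup>* L (xs @ L)"
  using assms
proof (induction xs rule: rev_induct)
  case (snoc a xs)
  have "ins\<^sup>*\<^sup>* L (xs @ L)" by (rule snoc.IH) (use snoc.prems in auto)
  moreover have "ins (xs @ L @ []) (xs @ a # L @ [])"
  proof (rule ins_before)
    show "\<forall>x\<in>set (xs @ L @ []). E a x \<longleftrightarrow> x \<in> set L"
    proof
      fix x assume "x \<in> set (xs @ L @ [])"
      then consider "x \<in> set xs" "x \<notin> set L" | "x \<in> set L" using snoc.prems(2) by auto
      then show "E a x \<longleftrightarrow> x \<in> set L" using snoc.prems(3)[of a x] snoc.prems(4)[of a x] by cases auto
    qed
  qed (use snoc.prems in auto)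
  ultimately show ?case by simp
qed simp

lemma ins_many_after:
  assumes "distinct xs" "set xs \<inter> set L = {}" "\<And>x y. x \<in> set xs \<Longrightarrow> y \<in> set L \<union> set xs \<Longrightarrow> \<not> E x y"
  shows "ins\<^sup>*\<^sup>* L (L @ xs)"
  using assms
proof (induction xs rule: rev_induct)
  case (snoc a xs)
  have "ins\<^sup>*\<^sup>* L (L @ xs)" by (rule snoc.IH) (use snoc.prems in auto)
  moreover have "ins ((L @ xs) @ [] @ []) ((L @ xs) @ [] @ a # [])"
    by (rule ins_after) (use snoc.prems in auto)
  ultimately show ?case by simp
qed simp

text \<open>\<open>K\<close> is built around \<open>u\<close> inside the list for
  \<open>C - K\<close>, where its vertices have no neighbour other than \<open>u\<close>. The part
  that comes later therefore lies closer to \<open>u\<close>.\<close>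

lemma ins_component_combine:
  assumes C: "comp_union u v C" and K: "comp_union u v K" "K \<subseteq> C"
    and A1: "ins\<^sup>*\<^sup>* [u] (A1 @ [u] @ B1)" "set A1 \<union> set B1 = C - K"
    and A2: "ins\<^sup>*\<^sup>* [u] (A2 @ [u] @ B2)" "set A2 \<union> set B2 = K"
  shows "ins\<^sup>*\<^sup>* [u] ((A1 @ A2) @ [u] @ (B2 @ B1))"
proof -
  have "ins\<^sup>*\<^sup>* (A1 @ [u] @ B1) (A1 @ (A2 @ [u] @ B2) @ B1)"
  proof (rule ins_rtrancl_context[OF A2(1)])
    show "set [u] \<inter> (set A1 \<union> set B1) = {}" using A1(2) comp_union_notin[OF C] by simp
    fix w assume w: "w \<in> set (A2 @ [u] @ B2)" "w \<notin> set [u]"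
    then have wK: "w \<in> K" using A2(2) by auto
    have "\<not> E w x" if "x \<in> C - K" for x
      using comp_union_nbr[OF K(1) wK, of x] that comp_union_notin[OF C] by blast
    then show "w \<notin> set A1 \<union> set B1 \<and> (\<forall>x\<in>set A1 \<union> set B1. \<not> E w x)"
      unfolding A1(2) using wK by blast
  qed
  then show ?thesis using A1(1) by simp
qed

end

section \<open>Insertion sequences for components\<close>

context sp_graph
begin

text \<open>Vertices of \<open>D1\<close> do not see \<open>v\<close>, so lightness makes them
  neighbours of \<open>u\<close>. If \<open>D1\<close> is nonempty, then \<open>(u, d)\<close> is a
  separation pair, so \<open>d\<close> is not adjacent to \<open>u\<close> and must be adjacent to
  \<open>v\<close>; this in turn forces \<open>D2\<close> to be empty, as otherwise
  \<open>(d, v)\<close> would be a separation pair joined by an edge.\<close>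

lemma separator_light:
  assumes K: "comp_union u v K" "K \<noteq> {}" "connected_on E K" "V - {u, v} - K \<noteq> {}"
    and light: "\<forall>x\<in>K. E x u \<or> E x v"
  obtains d D1 D2 where "K = insert d (D1 \<union> D2)" "d \<notin> D1" "d \<notin> D2" "D1 \<inter> D2 = {}"
    "comp_union u d D1" "comp_union d v D2"
    "\<And>x. x \<in> D1 \<Longrightarrow> E x u \<and> \<not> E x v" "\<And>x. x \<in> D2 \<Longrightarrow> E x v \<and> \<not> E x u"
    "D1 \<noteq> {} \<Longrightarrow> \<not> E d u \<and> E d v \<and> D2 = {}"
    "D2 \<noteq> {} \<Longrightarrow> \<not> E d v \<and> E d u \<and> D1 = {}"
proof -
  obtain d D1 D2 where D: "K = insert d (D1 \<union> D2)" "d \<notin> D1" "d \<notin> D2" "D1 \<inter> D2 = {}"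
    "comp_union u d D1" "comp_union d v D2"
    using separator[OF K(1-3)] K(4) by blast
  have uv: "u \<in> V" "v \<in> V" "u \<noteq> v" "u \<notin> K" "v \<notin> K" using K(1) by (auto simp: comp_union_def)
  have ud: "\<not> E d u" if "D1 \<noteq> {}"
  proof -
    have "v \<in> V - {u, d} - D1" using uv D(1) by blast
    then show ?thesis using comp_union_not_adj[OF D(5) that] adj_sym[of d u] by blast
  qed
  have dv: "\<not> E d v" if "D2 \<noteq> {}"
  proof -
    have "u \<in> V - {d, v} - D2" using uv D(1) by blast
    then show ?thesis using comp_union_not_adj[OF D(6) that] by blast
  qed
  have 1: "E x u \<and> \<not> E x v" if "x \<in> D1" for x
    using comp_union_nbr[OF D(5) that, of v] uv light D(1) that by blast
  have 2: "E x v \<and> \<not> E x u" if "x \<in> D2" for x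
    using comp_union_nbr[OF D(6) that, of u] uv light D(1) that by blast
  have d: "E d u \<or> E d v" using light D(1) by blast
  show thesis by (rule that[OF D 1 2]) (use ud dv d in blast)+
qed

text \<open>This makes the non-central vertices of a light component leaves. By
  \<open>separator_light\<close>, a nonempty \<open>D1\<close> in a component of \<open>D\<close>
  would make its separator a non-neighbour of \<open>u\<close>, and a nonempty \<open>D2\<close>
  would consist of such vertices; hence each component is a single vertex.\<close>

lemma light_leaves:
  assumes D: "comp_union u d D" and out: "V - {u, d} - D \<noteq> {}"
    and light: "\<forall>x\<in>D. E x u"
  shows "\<forall>x\<in>D. E x d" "\<forall>x\<in>D. \<forall>y\<in>D. \<not> E x y"
proof -
  have "E x d \<and> (\<forall>y\<in>D. \<not> E x y)" if x: "x \<in> D" for x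
  proof -
    obtain K where K: "K \<in> components_of E D" "x \<in> K" using component_exists[OF x] by blast
    have K': "comp_union u d K" "K \<noteq> {}" "connected_on E K" "K \<subseteq> D"
      using comp_union_component[OF D K(1)] K(1) by (auto simp: components_of_iff)
    have outK: "V - {u, d} - K \<noteq> {}" using out K'(4) by blast
    have lK: "\<forall>x\<in>K. E x u \<or> E x d" using light K'(4) by blast
    obtain c D1 D2 where c: "K = insert c (D1 \<union> D2)"
      and c1: "D1 \<noteq> {} \<Longrightarrow> \<not> E c u \<and> E c d \<and> D2 = {}" and c2: "\<And>x. x \<in> D2 \<Longrightarrow> E x d \<and> \<not> E x u"
      by (rule separator_light[OF K'(1-3) outK lK]) blast
    have "D1 = {}" using c1 light K'(4) c by blast
    moreover have "D2 = {}" using c2 light K'(4) c by blast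
    ultimately have Kx: "K = {x}" using c K(2) by blast
    then have "E x d" using comp_union_attach[OF comp_union_sym[OF K'(1)] K'(2)] adj_sym by blast
    moreover have "\<not> E x y" if "y \<in> D" for y
      using K(1) that irrefl unfolding Kx components_of_iff by blast
    ultimately show ?thesis by blast
  qed
  then show "\<forall>x\<in>D. E x d" "\<forall>x\<in>D. \<forall>y\<in>D. \<not> E x y" by blast+
qed

text \<open>Neighbours of \<open>v\<close> go to the right of \<open>u\<close> and all other
  vertices to the left, so that the right sides of several components merge into one block for
  \<open>v\<close>.\<close>

lemma ins_light_component:
  assumes K: "comp_union u v K" "K \<noteq> {}" "connected_on E K" "V - {u, v} - K \<noteq> {}"
    and light: "\<forall>x\<in>K. E x u \<or> E x v"
  shows "\<exists>A B. ins\<^sup>*\<^sup>* [u] (A @ [u] @ B) \<and> set A = {x \<in> K. \<not> E x v} \<and> set B = {x \<in> K. E x v}"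
proof -
  obtain d D1 D2 where D: "K = insert d (D1 \<union> D2)" "d \<notin> D1" "d \<notin> D2" "D1 \<inter> D2 = {}"
    "comp_union u d D1" "comp_union d v D2"
    and l1: "\<And>x. x \<in> D1 \<Longrightarrow> E x u \<and> \<not> E x v" and l2: "\<And>x. x \<in> D2 \<Longrightarrow> E x v \<and> \<not> E x u"
    and n1: "D1 \<noteq> {} \<Longrightarrow> \<not> E d u \<and> E d v \<and> D2 = {}"
    and n2: "D2 \<noteq> {} \<Longrightarrow> \<not> E d v \<and> E d u \<and> D1 = {}"
    by (rule separator_light[OF K light]) blast
  have uv: "u \<in> V" "v \<in> V" "u \<noteq> v" "u \<notin> K" "v \<notin> K" "K \<subseteq> V" using K(1) by (auto simp: comp_union_def)
  have finK: "finite D1" "finite D2" using finite_subset[OF uv(6) fin] D(1) by auto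
  consider "D1 \<noteq> {}" | "D2 \<noteq> {}" | "D1 = {}" "D2 = {}" by blast
  then show ?thesis
  proof cases
    case 1
    have d: "\<not> E d u" "E d v" "D2 = {}" using n1 1 by auto
    have "v \<in> V - {u, d} - D1" using uv D(1) by blast
    then have D1: "\<forall>x\<in>D1. E x d" "\<forall>x\<in>D1. \<forall>y\<in>D1. \<not> E x y" using light_leaves[OF D(5)] l1 by blast+
    obtain xs where xs: "set xs = D1" "distinct xs" using finite_distinct_list[OF finK(1)] by blast
    \<comment> \<open>The centre \<open>d\<close> is not adjacent to \<open>u\<close>, so its block
      is empty; each leaf then spans \<open>u\<close> and \<open>d\<close> from the left.\<close>
    have "ins ([u] @ [] @ []) ([u] @ [] @ d # [])" by (rule ins_after) (use d uv D(1) in auto)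
    moreover have "ins\<^sup>*\<^sup>* [u, d] (xs @ [u, d])"
      by (rule ins_many_before) (use xs D1 l1 D uv in auto)
    ultimately have "ins\<^sup>*\<^sup>* [u] (xs @ [u] @ [d])" by simp
    moreover have "set xs = {x \<in> K. \<not> E x v}" "set [d] = {x \<in> K. E x v}"
      using xs D(1) d l1 by auto
    ultimately show ?thesis by blast
  next
    case 2
    have d: "\<not> E d v" "E d u" "D1 = {}" using n2 2 by auto
    have "u \<in> V - {v, d} - D2" using uv D(1) by blast
    then have D2: "\<forall>x\<in>D2. E x d" "\<forall>x\<in>D2. \<forall>y\<in>D2. \<not> E x y"
      using light_leaves[OF comp_union_sym[OF D(6)]] l2 by blast+
    obtain xs where xs: "set xs = D2" "distinct xs" using finite_distinct_list[OF finK(2)] by blast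
    have "ins\<^sup>*\<^sup>* [u] ([u] @ xs)"
      by (rule ins_many_after) (use xs D2 l2 D uv in auto)
    \<comment> \<open>Here the leaves are not adjacent to \<open>u\<close> and come before the
      centre; \<open>d\<close> then spans \<open>u\<close> and all of them from the left.\<close>
    moreover have "ins ([] @ (u # xs) @ []) ([] @ d # (u # xs) @ [])"
    proof (rule ins_before)
      have "E d x" if "x \<in> D2" for x using D2(1) that adj_sym by blast
      then show "\<forall>x\<in>set ([] @ (u # xs) @ []). E d x \<longleftrightarrow> x \<in> set (u # xs)" using xs d by auto
    qed (use xs D uv in auto)
    ultimately have "ins\<^sup>*\<^sup>* [u] ([d] @ [u] @ xs)" by simp
    moreover have "set [d] = {x \<in> K. \<not> E x v}" "set xs = {x \<in> K. E x v}"
      using xs D(1) d l2 by auto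
    ultimately show ?thesis by blast
  next
    case 3
    then have Kd: "K = {d}" using D(1) by blast
    have d: "E d u" "E d v"
      using comp_union_attach[OF K(1,2)] comp_union_attach[OF comp_union_sym[OF K(1)] K(2)] Kd adj_sym by blast+
    have "ins ([] @ [u] @ []) ([] @ [u] @ d # [])" by (rule ins_after) (use d uv Kd in auto)
    then have "ins\<^sup>*\<^sup>* [u] ([] @ [u] @ [d])" by auto
    moreover have "set [] = {x \<in> K. \<not> E x v}" "set [d] = {x \<in> K. E x v}" using Kd d by auto
    ultimately show ?thesis by blast
  qed
qed

lemma ins_light:
  assumes "comp_union u v C" "V - {u, v} - C \<noteq> {}" "\<forall>x\<in>C. E x u \<or> E x v"
  shows "\<exists>A B. ins\<^sup>*\<^sup>* [u] (A @ [u] @ B) \<and> set A = {x \<in> C. \<not> E x v} \<and> set B = {x \<in> C. E x v}"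
  using assms
proof (induction "card C" arbitrary: C rule: less_induct)
  case less
  note C = less.prems
  show ?case
  proof (cases "C = {}")
    case True
    show ?thesis by (rule exI[of _ "[]"], rule exI[of _ "[]"]) (use True in auto)
  next
    case False
    then obtain x where x: "x \<in> C" by blast
    obtain K where K: "K \<in> components_of E C" "x \<in> K" using component_exists[OF x] by blast
    have K': "comp_union u v K" "K \<noteq> {}" "connected_on E K" "K \<subseteq> C"
      using comp_union_component[OF C(1) K(1)] K(1) by (auto simp: components_of_iff)
    have finC: "finite C" using C(1) fin finite_subset[of C V] by (auto simp: comp_union_def)
    have outs: "V - {u, v} - K \<noteq> {}" "V - {u, v} - (C - K) \<noteq> {}" using C(2) K'(4) by blast+
    have "card (C - K) < card C" using finC x K(2) by (intro psubset_card_mono) auto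
    then obtain A1 B1 where 1: "ins\<^sup>*\<^sup>* [u] (A1 @ [u] @ B1)" "set A1 = {x \<in> C - K. \<not> E x v}" "set B1 = {x \<in> C - K. E x v}"
      using less.hyps[OF _ comp_union_Diff[OF C(1) K'(1)] outs(2)] C(3) by blast
    have "\<forall>x\<in>K. E x u \<or> E x v" using C(3) K'(4) by blast
    then obtain A2 B2 where 2: "ins\<^sup>*\<^sup>* [u] (A2 @ [u] @ B2)" "set A2 = {x \<in> K. \<not> E x v}" "set B2 = {x \<in> K. E x v}"
      using ins_light_component[OF K'(1-3) outs(1)] by blast
    have "ins\<^sup>*\<^sup>* [u] ((A1 @ A2) @ [u] @ (B2 @ B1))"
      by (rule ins_component_combine[OF C(1) K'(1,4) 1(1) _ 2(1)]) (use 1 2 in auto)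
    moreover have "set (A1 @ A2) = {x \<in> C. \<not> E x v}" "set (B2 @ B1) = {x \<in> C. E x v}" using 1 2 K'(4) by auto
    ultimately show ?thesis by blast
  qed
qed

text \<open>\<open>r\<close> will consist of the ends of the root edge. All components met in the
  recursion avoid \<open>r\<close>, so at each pair at most one of them is heavy.\<close>

definition good_root :: "'a set \<Rightarrow> bool" where
  "good_root r \<longleftrightarrow> (\<forall>x y K K'. comp_union x y K \<and> comp_union x y K' \<and> connected_on E K \<and> connected_on E K' \<and>
     heavy E x y K \<and> heavy E x y K' \<and> K \<inter> r = {} \<and> K' \<inter> r = {} \<longrightarrow> K = K')"

text \<open>Here \<open>v\<close> is not yet present; the last conjunct lets it be inserted at the right end of \<open>B\<close>.
  At most one component can be heavy, because light ones end up with all their neighbours of \<open>v\<close>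
  as a block to the right of \<open>u\<close>, and only one further component fits in front of that block.\<close>

lemma ins_open:
  assumes good: "good_root r"
    and C: "comp_union u v C" "V - {u, v} - C \<noteq> {}" "C \<inter> r = {}"
  shows "\<exists>A B B1 B2. ins\<^sup>*\<^sup>* [u] (A @ [u] @ B) \<and> set A \<union> set B = C \<and>
    u # B = B1 @ B2 \<and> set B2 = {x \<in> insert u C. E x v}"
  using C
proof (induction "card C" arbitrary: u v C rule: less_induct)
  case less
  note C = less.prems
  have finC: "finite C" using C(1) fin finite_subset[of C V] by (auto simp: comp_union_def)
  have uv: "u \<in> V" "v \<in> V" "u \<noteq> v" "u \<notin> C" "v \<notin> C" "C \<subseteq> V" using C(1) by (auto simp: comp_union_def)
  consider "C = {}" | "C \<noteq> {}" "connected_on E C" | "C \<noteq> {}" "\<not> connected_on E C" by blast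
  then show ?case
  proof cases
    case 1
    \<comment> \<open>Only here may \<open>u\<close> itself be a neighbour of \<open>v\<close>; its
      block is then \<open>[u]\<close>, which is why the statement takes a suffix of
      \<open>u # B\<close> and not of \<open>B\<close>.\<close>
    show ?thesis
    proof (cases "E u v")
      case True
      show ?thesis by (rule exI[of _ "[]"], rule exI[of _ "[]"], rule exI[of _ "[]"], rule exI[of _ "[u]"]) (use 1 True in auto)
    next
      case False
      show ?thesis by (rule exI[of _ "[]"], rule exI[of _ "[]"], rule exI[of _ "[u]"], rule exI[of _ "[]"]) (use 1 False in auto)
    qed
  next
    case 2
    have nuv: "\<not> E u v" using comp_union_not_adj[OF C(1) 2(1) C(2)] .
    obtain d D1 D2 where D: "C = insert d (D1 \<union> D2)" "d \<notin> D1" "d \<notin> D2" "D1 \<inter> D2 = {}"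
      "comp_union u d D1" "comp_union d v D2"
      using separator[OF C(1) 2] C(2) by blast
    have card: "card D1 < card C" "card D2 < card C"
      by (rule psubset_card_mono[OF finC], use D(1-4) in blast)+
    have r: "D1 \<inter> r = {}" "D2 \<inter> r = {}" using C(3) D(1) by blast+
    have out: "V - {u, d} - D1 \<noteq> {}" "V - {d, v} - D2 \<noteq> {}" using uv D(1) by blast+
    obtain A1 B1 P1 P2 where 1: "ins\<^sup>*\<^sup>* [u] (A1 @ [u] @ B1)" "set A1 \<union> set B1 = D1"
      "u # B1 = P1 @ P2" "set P2 = {x \<in> insert u D1. E x d}"
      using less.hyps[OF card(1) D(5) out(1) r(1)] by blast
    obtain A2 B2 Q1 Q2 where 2: "ins\<^sup>*\<^sup>* [d] (A2 @ [d] @ B2)" "set A2 \<union> set B2 = D2"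
      "d # B2 = Q1 @ Q2" "set Q2 = {x \<in> insert d D2. E x v}"
      using less.hyps[OF card(2) D(6) out(2) r(2)] by blast
    \<comment> \<open>The list for \<open>(u, d)\<close> admits \<open>d\<close> at its right end,
      and \<open>d\<close> then starts the list for \<open>(d, v)\<close>. All neighbours of
      \<open>v\<close> lie in \<open>insert d D2\<close>, so the suffix \<open>Q2\<close> of the
      second list serves.\<close>
    have eq1: "A1 @ [u] @ B1 = (A1 @ P1) @ P2 @ []" using 1(3) by simp
    have s1: "set ((A1 @ P1) @ P2 @ []) = insert u D1" unfolding eq1[symmetric] using 1(2) by auto
    have "ins ((A1 @ P1) @ P2 @ []) ((A1 @ P1) @ P2 @ d # [])"
    proof (rule ins_after)
      show "d \<notin> set ((A1 @ P1) @ P2 @ [])" unfolding s1 using D(1,2) uv(4) by blast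
      show "\<forall>x\<in>set ((A1 @ P1) @ P2 @ []). E d x \<longleftrightarrow> x \<in> set P2" unfolding s1 1(4) using adj_sym by blast
    qed
    then have "ins (A1 @ [u] @ B1) ((A1 @ [u] @ B1) @ [d] @ [])" using 1(3) by simp
    moreover have "ins\<^sup>*\<^sup>* ((A1 @ [u] @ B1) @ [d] @ []) ((A1 @ [u] @ B1) @ (A2 @ [d] @ B2) @ [])"
    proof (rule ins_rtrancl_context[OF 2(1)])
      have s: "set (A1 @ [u] @ B1) \<union> set [] = insert u D1" using 1(2) by auto
      show "set [d] \<inter> (set (A1 @ [u] @ B1) \<union> set []) = {}" unfolding s using D(1,2) uv(4) by auto
      fix w assume "w \<in> set (A2 @ [d] @ B2)" "w \<notin> set [d]"
      then have w: "w \<in> D2" using 2(2) by auto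
      have "\<not> E w x" if "x \<in> insert u D1" for x
        using comp_union_nbr[OF D(6) w, of x] that uv D(1-4) by blast
      then show "w \<notin> set (A1 @ [u] @ B1) \<union> set [] \<and> (\<forall>x\<in>set (A1 @ [u] @ B1) \<union> set []. \<not> E w x)"
        unfolding s using w D(1,4) uv(4) by blast
    qed
    ultimately have "ins\<^sup>*\<^sup>* [u] (A1 @ [u] @ (B1 @ A2 @ [d] @ B2))" using 1(1) by simp
    moreover have "set A1 \<union> set (B1 @ A2 @ [d] @ B2) = C" using 1(2) 2(2) D(1) by auto
    moreover have "u # (B1 @ A2 @ [d] @ B2) = (u # B1 @ A2 @ Q1) @ Q2" using 2(3) by simp
    moreover have "set Q2 = {x \<in> insert u C. E x v}"
    proof -
      have "\<not> E x v" if "x \<in> D1" for x using comp_union_nbr[OF D(5) that, of v] uv D(1) by blast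
      then show ?thesis unfolding 2(4) using nuv D(1) by blast
    qed
    ultimately show ?thesis by blast
  next
    case 3
    have nuv: "\<not> E u v" using comp_union_not_adj[OF C(1) 3(1) C(2)] .
    \<comment> \<open>\<open>K\<close> is heavy if any component is, so by \<open>good\<close> all
      the others are light.\<close>
    obtain K where K: "K \<in> components_of E C" "(\<exists>H\<in>components_of E C. heavy E u v H) \<Longrightarrow> heavy E u v K"
      using component_exists[of _ C] 3(1) by blast
    have K': "comp_union u v K" "K \<noteq> {}" "connected_on E K" "K \<subseteq> C"
      using comp_union_component[OF C(1) K(1)] K(1) by (auto simp: components_of_iff)
    have light: "\<forall>x\<in>C - K. E x u \<or> E x v"
    proof (rule ballI, rule ccontr)
      fix x assume x: "x \<in> C - K" "\<not> (E x u \<or> E x v)"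
      then obtain H where H: "H \<in> components_of E C" "x \<in> H" using component_exists[of x C] by blast
      have hH: "heavy E u v H" using H(2) x(2) by (auto simp: heavy_def)
      then have hK: "heavy E u v K" using K(2) H(1) by blast
      have H': "comp_union u v H" "connected_on E H" "H \<subseteq> C"
        using comp_union_component[OF C(1) H(1)] H(1) by (auto simp: components_of_iff)
      have "K \<inter> r = {}" "H \<inter> r = {}" using C(3) K'(4) H'(3) by blast+
      then have "K = H" using good K'(1,3) H'(1,2) hH hK unfolding good_root_def by blast
      then show False using H(2) x(1) by blast
    qed
    have "K \<noteq> C" using K'(3) 3(2) by blast
    then have card: "card K < card C" using finC K'(4) by (intro psubset_card_mono) auto
    have outs: "V - {u, v} - K \<noteq> {}" "V - {u, v} - (C - K) \<noteq> {}" "K \<inter> r = {}" using C(2,3) K'(4) by blast+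
    obtain A1 B1 where 1: "ins\<^sup>*\<^sup>* [u] (A1 @ [u] @ B1)" "set A1 = {x \<in> C - K. \<not> E x v}" "set B1 = {x \<in> C - K. E x v}"
      using ins_light[OF comp_union_Diff[OF C(1) K'(1)] outs(2) light] by blast
    obtain A2 B2 Q1 Q2 where 2: "ins\<^sup>*\<^sup>* [u] (A2 @ [u] @ B2)" "set A2 \<union> set B2 = K"
      "u # B2 = Q1 @ Q2" "set Q2 = {x \<in> insert u K. E x v}"
      using less.hyps[OF card K'(1) outs(1,3)] by blast
    have "ins\<^sup>*\<^sup>* [u] ((A1 @ A2) @ [u] @ (B2 @ B1))"
      by (rule ins_component_combine[OF C(1) K'(1,4) 1(1) _ 2(1,2)]) (use 1 in auto)
    moreover have "set (A1 @ A2) \<union> set (B2 @ B1) = C" using 1(2,3) 2(2) K'(4) by auto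
    \<comment> \<open>\<open>B1\<close> contains only neighbours of \<open>v\<close>, so it prolongs
      the suffix \<open>Q2\<close> of the inner list.\<close>
    moreover have "u # (B2 @ B1) = Q1 @ (Q2 @ B1)" using 2(3) by simp
    moreover have "set (Q2 @ B1) = {x \<in> insert u C. E x v}" using 1(3) 2(4) nuv K'(4) by auto
    ultimately show ?thesis by blast
  qed
qed

text \<open>The separator \<open>d\<close> links the two halves: the list grown from
  \<open>s\<close> and the mirror image of the one grown from \<open>t\<close> bring all neighbours
  of \<open>d\<close> together as the block \<open>P2 @ rev Q2\<close>. The curve of
  \<open>d\<close> comes last and is the shallowest.\<close>

lemma ins_all:
  assumes E: "E s t" and good: "good_root {s, t}"
  shows "\<exists>L. ins\<^sup>*\<^sup>* [] L \<and> set L = V"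
proof -
  have st: "s \<in> V" "t \<in> V" "s \<noteq> t" using E adjV irrefl by auto
  define C where "C = V - {s, t}"
  have C: "comp_union s t C" using st by (auto simp: comp_union_def C_def)
  have "card V \<ge> 3" using biconn by (simp add: biconnected_def)
  moreover have "card {s, t} = 2" using st by simp
  ultimately have "C \<noteq> {}" using card_mono[of "{s, t}" V] by (auto simp: C_def)
  \<comment> \<open>The ends of an edge are never a separation pair, so a single component remains;
    there \<open>separator\<close> applies through its alternative \<open>E u v\<close>.\<close>
  moreover have "connected_on E C"
    using ntrans E st unfolding no_transitive_edges_def separation_pair_def C_def by blast
  ultimately obtain d D1 D2 where D: "C = insert d (D1 \<union> D2)" "d \<notin> D1" "d \<notin> D2" "D1 \<inter> D2 = {}"
      "comp_union s d D1" "comp_union d t D2"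
    using separator[OF C] E by blast
  have D2: "comp_union t d D2" using comp_union_sym[OF D(6)] .
  have nC: "s \<notin> C" "t \<notin> C" by (auto simp: C_def)
  have out: "V - {s, d} - D1 \<noteq> {}" "V - {t, d} - D2 \<noteq> {}" using st D(1) nC by blast+
  have r: "D1 \<inter> {s, t} = {}" "D2 \<inter> {s, t} = {}" using D(1) nC by blast+
  obtain A1 B1 P1 P2 where 1: "ins\<^sup>*\<^sup>* [s] (A1 @ [s] @ B1)" "set A1 \<union> set B1 = D1"
      "s # B1 = P1 @ P2" "set P2 = {x \<in> insert s D1. E x d}"
    using ins_open[OF good D(5) out(1) r(1)] by blast
  obtain A2 B2 Q1 Q2 where 2: "ins\<^sup>*\<^sup>* [t] (A2 @ [t] @ B2)" "set A2 \<union> set B2 = D2"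
      "t # B2 = Q1 @ Q2" "set Q2 = {x \<in> insert t D2. E x d}"
    using ins_open[OF good D2 out(2) r(2)] by blast
  have "ins ([] @ [] @ []) ([] @ [] @ s # [])" by (rule ins_after) auto
  moreover have "ins ([] @ [s] @ []) ([] @ [s] @ t # [])" 
    by (rule ins_after) (use E adj_sym[OF E] st in auto)
  moreover have "ins\<^sup>*\<^sup>* ([] @ [s] @ [t]) ([] @ (A1 @ [s] @ B1) @ [t])"
  proof (rule ins_rtrancl_context[OF 1(1)])
    fix w assume "w \<in> set (A1 @ [s] @ B1)" "w \<notin> set [s]"
    then have w: "w \<in> D1" using 1(2) by auto
    then show "w \<notin> set [] \<union> set [t] \<and> (\<forall>x\<in>set [] \<union> set [t]. \<not> E w x)"
      using comp_union_nbr[OF D(5) w, of t] D(1) nC st by auto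
  qed (use st in auto)
  moreover have "ins\<^sup>*\<^sup>* ((A1 @ [s] @ B1) @ rev [t] @ []) ((A1 @ [s] @ B1) @ rev (A2 @ [t] @ B2) @ [])"
  proof (rule ins_rtrancl_context[OF ins_rtrancl_rev[OF 2(1)]])
    have s: "set (A1 @ [s] @ B1) \<union> set [] = insert s D1" using 1(2) by auto
    show "set (rev [t]) \<inter> (set (A1 @ [s] @ B1) \<union> set []) = {}" unfolding s using D(1) nC st by auto
    fix w assume "w \<in> set (rev (A2 @ [t] @ B2))" "w \<notin> set (rev [t])"
    then have w: "w \<in> D2" using 2(2) by auto
    have "\<not> E w x" if "x \<in> insert s D1" for x
      using comp_union_nbr[OF D2 w, of x] that st D(1-4) nC by blast
    then show "w \<notin> set (A1 @ [s] @ B1) \<union> set [] \<and> (\<forall>x\<in>set (A1 @ [s] @ B1) \<union> set []. \<not> E w x)"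
      unfolding s using w D(1,4) nC by blast
  qed
  moreover have "ins ((A1 @ P1) @ (P2 @ rev Q2) @ (rev Q1 @ rev A2)) ((A1 @ P1) @ d # (P2 @ rev Q2) @ (rev Q1 @ rev A2))"
  proof (rule ins_before)
    have "set ((A1 @ P1) @ (P2 @ rev Q2) @ (rev Q1 @ rev A2)) = set A1 \<union> set (s # B1) \<union> set (t # B2) \<union> set A2"
      unfolding 1(3) 2(3) by auto
    also have "\<dots> = insert s D1 \<union> insert t D2" using 1(2) 2(2) by auto
    finally have s: "set ((A1 @ P1) @ (P2 @ rev Q2) @ (rev Q1 @ rev A2)) = insert s D1 \<union> insert t D2" .
    show "d \<notin> set ((A1 @ P1) @ (P2 @ rev Q2) @ (rev Q1 @ rev A2))" unfolding s using D(1-3) nC by blast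
    have P: "set (P2 @ rev Q2) = {x \<in> insert s D1 \<union> insert t D2. E x d}" using 1(4) 2(4) by auto
    show "\<forall>x\<in>set ((A1 @ P1) @ (P2 @ rev Q2) @ (rev Q1 @ rev A2)). E d x \<longleftrightarrow> x \<in> set (P2 @ rev Q2)"
      unfolding s P using adj_sym by blast
  qed
  moreover have eq: "(A1 @ [s] @ B1) @ rev (A2 @ [t] @ B2) @ [] = (A1 @ P1) @ (P2 @ rev Q2) @ (rev Q1 @ rev A2)"
  proof -
    have "rev B2 @ [t] = rev Q2 @ rev Q1" using arg_cong[OF 2(3), of rev] by simp
    then show ?thesis using 1(3) by simp
  qed
  ultimately have I: "ins\<^sup>*\<^sup>* [] ((A1 @ P1) @ d # (P2 @ rev Q2) @ (rev Q1 @ rev A2))"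
    unfolding eq by simp
  have "set ((A1 @ P1) @ d # (P2 @ rev Q2) @ (rev Q1 @ rev A2)) = insert d (set (A1 @ (s # B1)) \<union> set (A2 @ (t # B2)))"
    unfolding 1(3) 2(3) by auto
  also have "\<dots> = insert s (insert t C)" using 1(2) 2(2) D(1) by auto
  also have "\<dots> = V" using st by (auto simp: C_def)
  finally show ?thesis using I by blast
qed

end

subsection \<open>A good root edge\<close>

context sp_graph
begin

definition heavy_comp :: "'a \<Rightarrow> 'a \<Rightarrow> 'a set \<Rightarrow> bool" where
  "heavy_comp x y K \<longleftrightarrow> comp_union x y K \<and> connected_on E K \<and> heavy E x y K"

lemma heavy_nonempty: "heavy E x y K \<Longrightarrow> K \<noteq> {}"
  by (auto simp: heavy_def)

lemma comp_union_disjoint: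
  assumes "comp_union x y K" "comp_union x y K'" "connected_on E K" "connected_on E K'" "K \<inter> K' \<noteq> {}"
  shows "K = K'"
proof -
  obtain z where "z \<in> K" "z \<in> K'" using assms(5) by blast
  moreover have "x \<in> V" "y \<in> V" "x \<noteq> y" using assms(1) by (auto simp: comp_union_def)
  ultimately show ?thesis
    using components_disjoint[of K "V - {x, y}" K' z] component_iff[of x y K] component_iff[of x y K'] assms by blast
qed

lemma at_most_2_heavyD:
  assumes a: "at_most_2_heavy V E"
    and K: "heavy_comp x y K1" "heavy_comp x y K2" "heavy_comp x y K3"
  shows "K1 = K2 \<or> K1 = K3 \<or> K2 = K3"
proof (rule ccontr)
  assume neq: "\<not> ?thesis"
  have xy: "x \<in> V" "y \<in> V" "x \<noteq> y" using K(1) by (auto simp: heavy_comp_def comp_union_def)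
  let ?H = "{C \<in> components_of E (V - {x, y}). heavy E x y C}"
  have "{K1, K2, K3} \<subseteq> ?H"
    using K component_iff[OF xy] heavy_nonempty unfolding heavy_comp_def by blast
  moreover have "finite ?H"
  proof (rule finite_subset)
    show "?H \<subseteq> Pow V" by (auto simp: components_of_iff)
  qed (use fin in simp)
  ultimately have "card {K1, K2, K3} \<le> card ?H" by (rule card_mono[rotated])
  moreover have "card {K1, K2, K3} = 3" using neq by auto
  moreover have "separation_pair V E x y"
  proof (rule comp_union_separation_pair[of x y K1])
    have "K2 \<inter> K1 = {}"
      using comp_union_disjoint[of x y K2 K1] K neq unfolding heavy_comp_def by blast
    moreover have "K2 \<noteq> {}" "K2 \<subseteq> V - {x, y}" using K(2) heavy_nonempty unfolding heavy_comp_def comp_union_def by auto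
    ultimately show "V - {x, y} - K1 \<noteq> {}" by blast
  qed (use K(1) heavy_nonempty in \<open>auto simp: heavy_comp_def\<close>)
  then have "card ?H \<le> 2" using a unfolding at_most_2_heavy_def by blast
  ultimately show False by simp
qed

text \<open>If some \<open>K\<close> is crowded, any edge meeting a smallest one is a good root: for a pair violating this,
  one of the two heavy components avoiding the root would be a smaller crowded set.\<close>

definition crowded :: "'a \<Rightarrow> 'a \<Rightarrow> 'a set \<Rightarrow> bool" where
  "crowded x y K \<longleftrightarrow> heavy_comp x y K \<and> (\<exists>K'. K' \<noteq> K \<and> heavy_comp x y K' \<and> V - {x, y} - K - K' \<noteq> {})"

text \<open>Only \<open>x\<close> is missing inside \<open>K\<close> and only \<open>y\<close>
  outside; since neither is a cut vertex, every part of the remaining graph reaches \<open>u\<close>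
  or \<open>v\<close>, and \<open>L\<close> joins these two. This rules out separation pairs with
  one vertex in a crowded component and the other beyond its pair.\<close>

lemma connected_V_minus:
  assumes K: "comp_union u v K" and x: "x \<in> K" and y: "y \<in> V - {u, v} - K"
    and out: "comp_union u v L" "L \<noteq> {}" "L \<inter> K = {}" "y \<notin> L" "connected_on E L"
  shows "connected_on E (V - {x, y})"
proof -
  have uv: "u \<in> V" "v \<in> V" "u \<noteq> v" "u \<notin> K" "v \<notin> K" "K \<subseteq> V" "u \<notin> L" "v \<notin> L" "L \<subseteq> V"
    using K out(1) by (auto simp: comp_union_def)
  have reach: "X \<inter> {u, v} \<noteq> {}" if X: "X \<subseteq> V - {x, y}" "X \<noteq> {}"
    and cl: "\<And>a b. a \<in> X \<Longrightarrow> b \<in> V - {x, y} \<Longrightarrow> E a b \<Longrightarrow> b \<in> X" for X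
  proof (rule ccontr)
    assume "\<not> X \<inter> {u, v} \<noteq> {}"
    then have no: "u \<notin> X" "v \<notin> X" by auto
    obtain a where a: "a \<in> X" using X by blast
    show False
    proof (cases "a \<in> K")
      case True
      have "connected_on E (V - {x})" using connected_minus x uv by blast
      then have "\<exists>c\<in>X \<inter> K. \<exists>b\<in>V - {x} - X \<inter> K. E c b"
        by (rule connected_on_cutD[of _ _ _ a u]) (use X(1) a True uv(1,4) x no(1) in auto)
      then obtain c b where cb: "c \<in> X \<inter> K" "b \<in> V - {x} - X \<inter> K" "E c b" by blast
      have "b \<in> K \<or> b = u \<or> b = v" using comp_union_nbr[OF K, of c b] cb by blast
      then have "b \<noteq> y" using y by blast
      then have "b \<in> X" using cl[of c b] cb by blast
      then show False using no cb \<open>b \<in> K \<or> b = u \<or> b = v\<close> by blast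
    next
      case False
      have yV: "y \<in> V" using y by blast
      have "connected_on E (V - {y})" using connected_minus yV by blast
      then have "\<exists>c\<in>X - K. \<exists>b\<in>V - {y} - (X - K). E c b"
        by (rule connected_on_cutD[of _ _ _ a u]) (use X(1) a False uv(1) y no(1) in auto)
      then obtain c b where cb: "c \<in> X - K" "b \<in> V - {y} - (X - K)" "E c b" by blast
      have "b \<notin> K"
        using comp_union_nbr[OF K, of b c] adj_sym[OF cb(3)] cb(1) no by blast
      then have "b \<noteq> x" using x by blast
      then have "b \<in> X" using cl[of c b] cb by blast
      then show False using cb \<open>b \<notin> K\<close> by blast
    qed
  qed
  show ?thesis unfolding connected_on_cut
  proof (intro allI impI, rule ccontr)
    fix X assume X: "X \<subseteq> V - {x, y}" "X \<noteq> {}" "X \<noteq> V - {x, y}" and no: "\<not> (\<exists>a\<in>X. \<exists>b\<in>V - {x, y} - X. E a b)"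
    define Y where "Y = V - {x, y} - X"
    have Y: "Y \<subseteq> V - {x, y}" "Y \<noteq> {}" using X by (auto simp: Y_def)
    have clX: "b \<in> X" if "a \<in> X" "b \<in> V - {x, y}" "E a b" for a b using no that by blast
    have clY: "b \<in> Y" if "a \<in> Y" "b \<in> V - {x, y}" "E a b" for a b
      using no that adj_sym[OF that(3)] unfolding Y_def by blast
    have uvX: "X \<inter> {u, v} \<noteq> {}" using reach[OF X(1,2)] clX by blast
    have uvY: "Y \<inter> {u, v} \<noteq> {}" using reach[OF Y] clY by blast
    have L: "L \<subseteq> V - {x, y}" using out x uv by blast
    obtain l m where lm: "l \<in> L" "E u l" "m \<in> L" "E v m"
      using comp_union_attach[OF out(1,2)] comp_union_attach[OF comp_union_sym[OF out(1)] out(2)] by blast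
    have u: "u \<in> V - {x, y}" "v \<in> V - {x, y}" using uv x y by blast+
    have LZ: "L \<subseteq> Z" if Z: "Z \<inter> L \<noteq> {}" "\<And>a b. a \<in> Z \<Longrightarrow> b \<in> V - {x, y} \<Longrightarrow> E a b \<Longrightarrow> b \<in> Z" for Z
    proof -
      have "Z \<inter> L = L" by (rule connected_on_closed_eq[OF out(5)]) (use Z L in blast)+
      then show ?thesis by blast
    qed
    have uZ: "L \<subseteq> Z" if Z: "Z \<inter> {u, v} \<noteq> {}" "\<And>a b. a \<in> Z \<Longrightarrow> b \<in> V - {x, y} \<Longrightarrow> E a b \<Longrightarrow> b \<in> Z" for Z
    proof (rule LZ)
      show "Z \<inter> L \<noteq> {}" using Z(1) Z(2)[of u l] Z(2)[of v m] lm L by blast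
    qed (rule Z(2))
    have "L \<subseteq> X" by (rule uZ[OF uvX]) (rule clX)
    moreover have "L \<subseteq> Y" by (rule uZ[OF uvY]) (rule clY)
    ultimately show False using out(2) by (auto simp: Y_def)
  qed
qed

lemma good_root_exists:
  assumes a: "at_most_2_heavy V E"
  shows "\<exists>s t. E s t \<and> good_root {s, t}"
proof (cases "\<exists>u v H. crowded u v H")
  case False
  obtain s t where st: "E s t"
  proof -
    have "card V \<ge> 3" "connected_on E V" using biconn by (auto simp: biconnected_def)
    then have "V \<noteq> {}" by auto
    then obtain x where x: "x \<in> V" by blast
    have "V \<noteq> {x}" using \<open>card V \<ge> 3\<close> by auto
    then obtain y where "y \<in> V" "y \<noteq> x" using x by blast
    then show thesis using connected_on_cutD[OF \<open>connected_on E V\<close>, of "{x}" x y] x that by blast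
  qed
  have "good_root {s, t}"
    unfolding good_root_def
  proof (intro allI impI, elim conjE, rule ccontr)
    fix x y K K'
    assume K: "comp_union x y K" "comp_union x y K'" "connected_on E K" "connected_on E K'"
      "heavy E x y K" "heavy E x y K'" "K \<inter> {s, t} = {}" "K' \<inter> {s, t} = {}" "K \<noteq> K'"
    \<comment> \<open>Otherwise \<open>K\<close> would be crowded. The edge avoiding
      \<open>K\<close> and \<open>K'\<close> must then join \<open>x\<close> and \<open>y\<close>,
      which are not adjacent.\<close>
    have "V - {x, y} - K - K' = {}" using False K unfolding crowded_def heavy_comp_def by blast
    then have "s \<in> {x, y}" "t \<in> {x, y}" using adjV[OF st] K by blast+
    then have "E x y" using st irrefl adj_sym by blast
    moreover have "K \<inter> K' = {}" using comp_union_disjoint[OF K(1-4)] K(9) by blast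
    then have "V - {x, y} - K \<noteq> {}" using K(2) heavy_nonempty[OF K(6)] by (auto simp: comp_union_def)
    ultimately show False using comp_union_not_adj[OF K(1) heavy_nonempty[OF K(5)]] by blast
  qed
  then show ?thesis using st by blast
next
  case True
  define P where "P H \<longleftrightarrow> (\<exists>u v. crowded u v H)" for H
  obtain H where H: "P H" "\<And>H'. P H' \<Longrightarrow> card H \<le> card H'"
    using True exists_least_iff[of "\<lambda>n. \<exists>H. P H \<and> card H = n"] unfolding P_def
    by (metis not_less)
  then obtain u v H2 where uv: "heavy_comp u v H" "H2 \<noteq> H" "heavy_comp u v H2" "V - {u, v} - H - H2 \<noteq> {}"
    unfolding P_def crowded_def by blast
  have cH: "comp_union u v H" "connected_on E H" "heavy E u v H" using uv(1) by (auto simp: heavy_comp_def)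
  have cH2: "comp_union u v H2" "connected_on E H2" "heavy E u v H2" using uv(3) by (auto simp: heavy_comp_def)
  have dis: "H \<inter> H2 = {}" using comp_union_disjoint[OF cH(1) cH2(1) cH(2) cH2(2)] uv(2) by blast
  have uvV: "u \<in> V" "v \<in> V" "u \<noteq> v" "u \<notin> H" "v \<notin> H" "H \<subseteq> V" using cH(1) by (auto simp: comp_union_def)
  have Hne: "H \<noteq> {}" "H2 \<noteq> {}" using heavy_nonempty cH cH2 by blast+
  obtain z where z: "z \<in> H" "\<not> E z u" "\<not> E z v" using cH(3) by (auto simp: heavy_def)
  obtain s where s: "s \<in> H" "E u s" using comp_union_attach[OF cH(1) Hne(1)] by blast
  have "good_root {s, u}"
    unfolding good_root_def
  proof (intro allI impI, elim conjE, rule ccontr)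
    fix x y K K'
    assume K: "comp_union x y K" "comp_union x y K'" "connected_on E K" "connected_on E K'"
      "heavy E x y K" "heavy E x y K'" "K \<inter> {s, u} = {}" "K' \<inter> {s, u} = {}" "K \<noteq> K'"
    have xyV: "x \<in> V" "y \<in> V" "x \<noteq> y" using K(1) by (auto simp: comp_union_def)
    have KK: "K \<inter> K' = {}" using comp_union_disjoint[OF K(1-4)] K(9) by blast
    have nesep: "V - {x, y} - K \<noteq> {}" using KK K(2) heavy_nonempty[OF K(6)] by (auto simp: comp_union_def)
    have sep: "separation_pair V E x y" using comp_union_separation_pair[OF K(1) heavy_nonempty[OF K(5)] nesep] .
    have nxy: "\<not> E x y" using comp_union_not_adj[OF K(1) heavy_nonempty[OF K(5)] nesep] .
    \<comment> \<open>The root edge does not join \<open>x\<close> and \<open>y\<close>, so one of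
      its ends lies in a third component, which makes both \<open>K\<close> and \<open>K'\<close>
      crowded.\<close>
    have su: "{s, u} \<noteq> {x, y}" using nxy s(2) adj_sym[OF s(2)] by (auto simp: doubleton_eq_iff)
    have third: "V - {x, y} - K - K' \<noteq> {}"
    proof -
      obtain w where "w \<in> {s, u}" "w \<notin> {x, y}" using su s(1) uvV(4) by blast
      then show ?thesis using K(7,8) s uvV by blast
    qed
    have third': "V - {x, y} - K' - K \<noteq> {}" using third by blast
    have hc: "heavy_comp x y K" "heavy_comp x y K'" using K by (simp_all add: heavy_comp_def)
    have cr: "P K" "P K'" unfolding P_def crowded_def using hc K(9) third third' by blast+
    \<comment> \<open>\<open>x'\<close> and \<open>y'\<close> are \<open>x\<close> and
      \<open>y\<close> in either order. If \<open>y'\<close> lies in \<open>H\<close> or is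
      \<open>u\<close> or \<open>v\<close>, then the connected set \<open>R\<close> meets at most
      one of \<open>K\<close> and \<open>K'\<close>; the other is contained in \<open>H\<close>
      without \<open>x'\<close>, against minimality.\<close>
    have key: False if xH: "x' \<in> H" and S: "{x', y'} = {x, y}" for x' y'
    proof (cases "y' \<in> H \<union> {u, v}")
      case True
      define R where "R = V - H - {y'}"
      consider "y' = u" | "y' = v" | "y' \<in> H" using True by blast
      then have R: "connected_on E R"
      proof cases
        case 1
        then show ?thesis using connected_outside[OF cH(1)] by (simp add: R_def)
      next
        case 2
        then show ?thesis using connected_outside[OF comp_union_sym[OF cH(1)]] by (simp add: R_def)
      next
        case 3
        obtain l where l: "l \<in> H2" "E u l" using comp_union_attach[OF cH2(1) Hne(2)] by blast
        then have "l \<in> V - H - {u}" using dis adjV irrefl by blast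
        then have "connected_on E (insert u (V - H - {u}))"
          using connected_on_insert[OF connected_outside[OF cH(1)]] adj_sym[OF l(2)] by blast
        moreover have "insert u (V - H - {u}) = R" using 3 uvV by (auto simp: R_def)
        ultimately show ?thesis by simp
      qed
      have RV: "R \<subseteq> V - {x, y}" using xH S by (auto simp: R_def)
      have sub: "R \<subseteq> M" if "comp_union x y M" "M \<inter> R \<noteq> {}" for M
      proof -
        have "M \<inter> R = R"
          by (rule connected_on_closed_eq[OF R]) (use that RV in \<open>auto simp: comp_union_def\<close>)
        then show ?thesis by blast
      qed
      have small: False if M: "comp_union x y M" "P M" "M \<inter> R = {}" for M
      proof -
        have "M \<subseteq> V - {x, y}" using M(1) by (simp add: comp_union_def)
        then have "M \<subset> H" using M(3) xH S unfolding R_def by blast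
        then have "card M < card H" using finite_subset[OF uvV(6) fin] by (rule psubset_card_mono[rotated])
        then show False using H(2)[OF M(2)] by simp
      qed
      have "R \<subseteq> K" "R \<subseteq> K'" using sub[OF K(1)] sub[OF K(2)] small[OF K(1) cr(1)] small[OF K(2) cr(2)] by blast+
      then have "R = {}" using KK by blast
      then show False using small[OF K(1) cr(1)] by blast
    next
      case False
      have y': "y' \<in> V - {u, v} - H" using False S xyV by (auto simp: doubleton_eq_iff)
      \<comment> \<open>If \<open>y'\<close> lies in \<open>H2\<close>, this set can no longer serve
        to join \<open>u\<close> and \<open>v\<close>; the third component in \<open>crowded\<close>
        is there for this case.\<close>
      obtain L where L: "comp_union u v L" "L \<noteq> {}" "L \<inter> H = {}" "y' \<notin> L" "connected_on E L"
      proof (cases "y' \<in> H2")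
        case False
        then show thesis using that[of H2] cH2 Hne(2) dis by blast
      next
        case True
        obtain w where w: "w \<in> V - {u, v} - H - H2" using uv(4) by blast
        then have "w \<in> V - {u, v}" by blast
        from component_exists[OF this] obtain L where "L \<in> components_of E (V - {u, v})" "w \<in> L" by blast
        then have L: "comp_union u v L" "L \<noteq> {}" "connected_on E L" using component_iff[OF uvV(1-3)] by blast+
        have "L \<inter> H = {}" using comp_union_disjoint[OF L(1) cH(1) L(3) cH(2)] w \<open>w \<in> L\<close> by blast
        moreover have "L \<inter> H2 = {}" using comp_union_disjoint[OF L(1) cH2(1) L(3) cH2(2)] w \<open>w \<in> L\<close> by blast
        ultimately show thesis using that[of L] L True by blast
      qed
      have "connected_on E (V - {x', y'})" by (rule connected_V_minus[OF cH(1) xH y' L])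
      then show False using sep unfolding S separation_pair_def by blast
    qed
    have xyH: "x \<notin> H" "y \<notin> H" using key[of x y] key[of y x] by blast+
    have sxy: "s \<in> V - {x, y}" using s xyH uvV by blast
    from component_exists[OF this] obtain L where L0: "L \<in> components_of E (V - {x, y})" "s \<in> L" by blast
    then have L: "comp_union x y L" "connected_on E L" using component_iff[OF xyV] by blast+
    \<comment> \<open>\<open>H\<close> now lies in the component of \<open>s\<close>, which is heavy
      because of \<open>z\<close>: all neighbours of \<open>z\<close> are in \<open>H\<close>. With
      \<open>K\<close> and \<open>K'\<close>, which avoid \<open>s\<close>, this would be a third
      heavy component.\<close>
    have "H \<inter> L = H"
      by (rule connected_on_closed_eq[OF cH(2)]) (use L(1) L0(2) s(1) xyH uvV(6) in \<open>auto simp: comp_union_def\<close>)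
    then have "z \<in> L" using z(1) by blast
    moreover have "\<not> E z x" "\<not> E z y" using comp_union_nbr[OF cH(1) z(1)] z(2,3) xyH by blast+
    ultimately have "heavy_comp x y L" using L unfolding heavy_comp_def heavy_def by blast
    then have "L = K \<or> L = K'" using at_most_2_heavyD[OF a _ hc(1) hc(2)] K(9) by blast
    then show False using L0(2) K(7,8) by blast
  qed
  then show ?thesis using s adj_sym by blast
qed

end

subsection \<open>Outerstring graphs are at most 2-heavy\<close>

context sp_graph
begin

text \<open>\<open>D2\<close> contains no neighbour of \<open>s\<close>, so from \<open>d\<close> or
  \<open>D2\<close> a component of \<open>D2\<close> leads to \<open>t\<close>. From
  \<open>D1\<close>, induction for \<open>(s, d)\<close> leads to a neighbour of \<open>d\<close>,
  and \<open>d\<close> itself is not adjacent to \<open>s\<close> because \<open>(s, d)\<close> is a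
  separation pair.\<close>

lemma avoiding_set:
  assumes C: "comp_union s t C" "connected_on E C" "V - {s, t} - C \<noteq> {}" and v: "v \<in> C" "\<not> E v s"
  shows "\<exists>X\<subseteq>C. connected_on E X \<and> v \<in> X \<and> (\<forall>x\<in>X. \<not> E x s) \<and> (\<exists>x\<in>X. E x t)"
  using assms
proof (induction "card C" arbitrary: s t C v rule: less_induct)
  case less
  note C = less.prems(1-3) and v = less.prems(4,5)
  have st: "s \<in> V" "t \<in> V" "s \<noteq> t" "s \<notin> C" "t \<notin> C" "C \<subseteq> V" using C(1) by (auto simp: comp_union_def)
  have Cne: "C \<noteq> {}" using v by blast
  obtain d D1 D2 where D: "C = insert d (D1 \<union> D2)" "d \<notin> D1" "d \<notin> D2" "D1 \<inter> D2 = {}"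
    "comp_union s d D1" "comp_union d t D2"
    using separator[OF C(1) Cne C(2)] C(3) by blast
  have D2s: "\<not> E x s" if "x \<in> D2" for x using comp_union_nbr[OF D(6) that, of s] st D(1) by blast
  have D1t: "\<not> E x t" if "x \<in> D1" for x using comp_union_nbr[OF D(5) that, of t] st D(1) by blast
  have comp2: "\<exists>K\<subseteq>D2. connected_on E K \<and> x \<in> K \<and> (\<exists>y\<in>K. E d y) \<and> (\<exists>y\<in>K. E y t)" if x: "x \<in> D2" for x
  proof -
    obtain K where K: "K \<in> components_of E D2" "x \<in> K" using component_exists[OF x] by blast
    have K': "comp_union d t K" "K \<noteq> {}" "connected_on E K" "K \<subseteq> D2"
      using comp_union_component[OF D(6) K(1)] K(1) by (auto simp: components_of_iff)
    then show ?thesis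
      using comp_union_attach[OF K'(1,2)] comp_union_attach[OF comp_union_sym[OF K'(1)] K'(2)] K(2) adj_sym by blast
  qed
  have from_d: "\<exists>X\<subseteq>insert d D2. connected_on E X \<and> d \<in> X \<and> (\<forall>x\<in>X. \<not> E x s) \<and> (\<exists>x\<in>X. E x t)" if ds: "\<not> E d s"
  proof (cases "D2 = {}")
    case True
    obtain x where "x \<in> C" "E t x" using comp_union_attach[OF comp_union_sym[OF C(1)] Cne] by blast
    then have "E d t" using D(1) True D1t adj_sym by blast
    then show ?thesis using ds by (intro exI[of _ "{d}"]) auto
  next
    case False
    then obtain x where "x \<in> D2" by blast
    from comp2[OF this] obtain K y where K: "K \<subseteq> D2" "connected_on E K" "y \<in> K" "E d y" "\<exists>y\<in>K. E y t" by blast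
    have "connected_on E (insert d K)" using connected_on_insert[OF K(2,3)] adj_sym[OF K(4)] by blast
    then show ?thesis using K ds D2s by (intro exI[of _ "insert d K"]) blast
  qed
  consider "v = d" | "v \<in> D2" | "v \<in> D1" using v(1) D(1) by blast
  then show ?case
  proof cases
    case 1
    have "insert d D2 \<subseteq> C" using D(1) by blast
    then show ?thesis using from_d v(2) unfolding 1 by (meson order_trans)
  next
    case 2
    from comp2[OF 2] obtain K where "K \<subseteq> D2" "connected_on E K" "v \<in> K" "\<exists>y\<in>K. E y t" by blast
    then show ?thesis using D(1) D2s by (intro exI[of _ K]) blast
  next
    case 3
    obtain K where K: "K \<in> components_of E D1" "v \<in> K" using component_exists[OF 3] by blast
    have K': "comp_union s d K" "connected_on E K" "K \<subseteq> D1"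
      using comp_union_component[OF D(5) K(1)] K(1) by (auto simp: components_of_iff)
    have finC: "finite C" using finite_subset[OF st(6) fin] .
    have card: "card K < card C" by (rule psubset_card_mono[OF finC]) (use K'(3) D(1,2) in blast)
    have out: "V - {s, d} - K \<noteq> {}" "V - {s, d} - D1 \<noteq> {}" using K'(3) D(1) st by blast+
    obtain X y where X: "X \<subseteq> K" "connected_on E X" "v \<in> X" "\<forall>x\<in>X. \<not> E x s" "y \<in> X" "E y d"
      using less.hyps[OF card K'(1,2) out(1) K(2) v(2)] by blast
    have "\<not> E d s" using comp_union_not_adj[OF D(5) _ out(2)] 3 adj_sym by blast
    from from_d[OF this] obtain Z where Z: "Z \<subseteq> insert d D2" "connected_on E Z" "d \<in> Z" "\<forall>x\<in>Z. \<not> E x s" "\<exists>x\<in>Z. E x t" by blast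
    have "connected_on E (X \<union> Z)" using connected_on_Un[OF X(2) Z(2) X(5) Z(3)] X(6) by blast
    moreover have "X \<union> Z \<subseteq> C" using X(1) Z(1) K'(3) D(1) by blast
    ultimately show ?thesis using X(3,4) Z(4,5) by (intro exI[of _ "X \<union> Z"]) blast
  qed
qed

end

text \<open>\<open>fashoda_interlace\<close> needs a box in \<open>real^2\<close> with the four ends
  on its bottom side. Therefore \<open>h\<close> turns the half plane upside down and moves the line
  to height 0; a norm bound \<open>M\<close> for both curves supplies the box.\<close>

lemma fashoda_below_line:
  fixes f g :: "real \<Rightarrow> real \<times> real"
  assumes "path f" "path g" "\<And>z. z \<in> path_image f \<union> path_image g \<Longrightarrow> snd z \<le> c"
    and s: "snd (pathstart f) = c" "snd (pathfinish f) = c" "snd (pathstart g) = c" "snd (pathfinish g) = c"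
    and lt: "fst (pathstart f) < fst (pathstart g)" "fst (pathstart g) < fst (pathfinish f)"
      "fst (pathfinish f) < fst (pathfinish g)"
  shows "path_image f \<inter> path_image g \<noteq> {}"
proof -
  define h :: "real \<times> real \<Rightarrow> real^2" where "h z = (\<chi> i. if i = 1 then fst z else c - snd z)" for z
  have h12: "h z $ 1 = fst z" "h z $ 2 = c - snd z" for z by (simp_all add: h_def)
  have cont: "continuous_on S h" for S
    unfolding h_def
  proof (rule continuous_on_vec_lambda)
    fix i :: 2
    show "continuous_on S (\<lambda>z. if i = 1 then fst z else c - snd z)"
      by (cases "i = 1") (auto intro!: continuous_intros)
  qed
  have inj: "z = z'" if "h z = h z'" for z z'
    using arg_cong[OF that, of "\<lambda>v. v $ 1"] arg_cong[OF that, of "\<lambda>v. v $ 2"] by (simp add: h12 prod_eq_iff)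
  have "bounded (path_image f \<union> path_image g)" using assms(1,2) by (simp add: bounded_path_image)
  then obtain M where M: "\<And>z. z \<in> path_image f \<union> path_image g \<Longrightarrow> norm z \<le> M" unfolding bounded_iff by blast
  define a b :: "real^2" where "a = vector [-M, 0]" and "b = vector [M, c + M]"
  have box: "h z \<in> cbox a b" if z: "z \<in> path_image f \<union> path_image g" for z
  proof -
    have "\<bar>fst z\<bar> \<le> M" "\<bar>snd z\<bar> \<le> M"
      using M[OF z] norm_fst_le[of "fst z" "snd z"] norm_snd_le[of "snd z" "fst z"] by auto
    then show ?thesis using assms(3)[OF z] by (auto simp: mem_box_cart forall_2 h12 a_def b_def vector_2)
  qed
  obtain w where w: "w \<in> path_image (h \<circ> f)" "w \<in> path_image (h \<circ> g)"
  proof (rule fashoda_interlace[of "h \<circ> f" "h \<circ> g" a b])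
    show "path (h \<circ> f)" "path (h \<circ> g)" using assms(1,2) cont by (auto intro: path_continuous_image)
    show "path_image (h \<circ> f) \<subseteq> cbox a b" "path_image (h \<circ> g) \<subseteq> cbox a b"
      using box by (auto simp: path_image_compose)
  qed (use s lt in \<open>auto simp: pathstart_compose pathfinish_compose h12 a_def vector_2\<close>)
  then show ?thesis using inj by (fastforce simp: path_image_compose)
qed

context sgraph
begin

context
  fixes c \<gamma> assumes rep: "grounded_string_rep V E c \<gamma>"
begin

abbreviation anchor :: "'a \<Rightarrow> real" where "anchor v \<equiv> fst (pathstart (\<gamma> v))"

lemma rep_path: "v \<in> V \<Longrightarrow> path (\<gamma> v)" and rep_start: "v \<in> V \<Longrightarrow> snd (pathstart (\<gamma> v)) = c"
  and rep_meet: "u \<in> V \<Longrightarrow> v \<in> V \<Longrightarrow> u \<noteq> v \<Longrightarrow> path_image (\<gamma> u) \<inter> path_image (\<gamma> v) \<noteq> {} \<longleftrightarrow> E u v"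
  using rep by (auto simp: grounded_string_rep_def arc_imp_path)

lemma rep_below: 
  assumes "v \<in> V" "z \<in> path_image (\<gamma> v)" shows "snd z \<le> c"
proof -
  obtain \<tau> where "\<tau> \<in> {0..1}" "z = \<gamma> v \<tau>" using assms(2) by (auto simp: path_image_def)
  moreover have "\<forall>\<tau>\<in>{0<..1}. snd (\<gamma> v \<tau>) < c" using rep assms(1) by (simp add: grounded_string_rep_def)
  moreover have "snd (\<gamma> v 0) = c" using rep_start[OF assms(1)] by (simp add: pathstart_def)
  ultimately show ?thesis by (cases "\<tau> = 0") (auto intro: less_imp_le)
qed

text \<open>Curves of adjacent vertices meet, so the union of the curves of a connected set is path
  connected.\<close>

lemma anchor_path:
  assumes X: "X \<subseteq> V" "connected_on E X" "p \<in> X" "q \<in> X"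
  obtains f where "path f" "path_image f \<subseteq> (\<Union>v\<in>X. path_image (\<gamma> v))" "pathstart f = pathstart (\<gamma> p)"
    "pathfinish f = pathstart (\<gamma> q)"
proof -
  let ?U = "\<Union>v\<in>X. path_image (\<gamma> v)"
  have within: "path_component ?U a b" if "v \<in> X" "a \<in> path_image (\<gamma> v)" "b \<in> path_image (\<gamma> v)" for v a b
  proof -
    have "path_connected (path_image (\<gamma> v))" using that X(1) rep_path by (blast intro: path_connected_path_image)
    then have "path_component (path_image (\<gamma> v)) a b" using that by (simp add: path_connected_component)
    then show ?thesis by (rule path_component_of_subset[rotated]) (use that in blast)
  qed
  have "(p, q) \<in> (induced_rel E X)\<^sup>*" using X by (simp add: connected_on_def)
  then have "path_component ?U (pathstart (\<gamma> p)) (pathstart (\<gamma> q))"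
  proof (induction rule: rtrancl_induct)
    case base
    show ?case by (rule within[of p]) (use X in auto)
  next
    case (step y z)
    then have yz: "y \<in> X" "z \<in> X" "E y z" "y \<noteq> z" using irrefl by (auto simp: induced_rel_def)
    then obtain w where w: "w \<in> path_image (\<gamma> y)" "w \<in> path_image (\<gamma> z)" using rep_meet X(1) by blast
    have "path_component ?U (pathstart (\<gamma> y)) w" by (rule within[of y]) (use yz w in auto)
    moreover have "path_component ?U w (pathstart (\<gamma> z))" by (rule within[of z]) (use yz w in auto)
    ultimately show ?case using step.IH path_component_trans by blast
  qed
  then show thesis using that unfolding path_component_def by blast
qed

lemma anchors_not_interlaced:
  assumes X: "X \<subseteq> V" "connected_on E X" "p \<in> X" "q \<in> X"
    and Y: "Y \<subseteq> V" "connected_on E Y" "r \<in> Y" "s \<in> Y"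
    and sep: "X \<inter> Y = {}" "\<And>x y. x \<in> X \<Longrightarrow> y \<in> Y \<Longrightarrow> \<not> E x y"
  shows "\<not> (anchor p < anchor r \<and> anchor r < anchor q \<and> anchor q < anchor s)"
proof
  assume lt: "anchor p < anchor r \<and> anchor r < anchor q \<and> anchor q < anchor s"
  obtain f where f: "path f" "path_image f \<subseteq> (\<Union>v\<in>X. path_image (\<gamma> v))" "pathstart f = pathstart (\<gamma> p)"
    "pathfinish f = pathstart (\<gamma> q)" by (rule anchor_path[OF X])
  obtain g where g: "path g" "path_image g \<subseteq> (\<Union>v\<in>Y. path_image (\<gamma> v))" "pathstart g = pathstart (\<gamma> r)"
    "pathfinish g = pathstart (\<gamma> s)" by (rule anchor_path[OF Y])
  have "path_image f \<inter> path_image g \<noteq> {}"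
  proof (rule fashoda_below_line[of f g c])
    fix z assume "z \<in> path_image f \<union> path_image g"
    then obtain v where "v \<in> V" "z \<in> path_image (\<gamma> v)" using f(2) g(2) X(1) Y(1) by blast
    then show "snd z \<le> c" by (rule rep_below)
  qed (use f g lt rep_start X Y in auto)
  then obtain z x y where "x \<in> X" "z \<in> path_image (\<gamma> x)" "y \<in> Y" "z \<in> path_image (\<gamma> y)" using f(2) g(2) by blast
  then show False using rep_meet[of x y] sep X(1) Y(1) by blast
qed

lemma anchor_neq:
  assumes "u \<in> V" "v \<in> V" "u \<noteq> v" "\<not> E u v"
  shows "anchor u \<noteq> anchor v"
proof
  assume "anchor u = anchor v"
  then have "pathstart (\<gamma> u) = pathstart (\<gamma> v)" using rep_start assms(1,2) by (simp add: prod_eq_iff)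
  then show False using rep_meet[OF assms(1-3)] assms(4) pathstart_in_path_image[of "\<gamma> u"] pathstart_in_path_image[of "\<gamma> v"]
    by auto
qed

end

end

section \<open>Three heavy components force a crossing\<close>

context sp_graph
begin

text \<open>With the line closed up at infinity, the anchors of \<open>s\<close> and
  \<open>t\<close> cut it into two arcs, and \<open>mid\<close> names the arc. If \<open>v\<close>
  and \<open>v'\<close> shared an arc, then \<open>{s, v}\<close> would interlace with
  \<open>{t, v'}\<close> or \<open>{s, v'}\<close> with \<open>{t, v}\<close>; the sets from
  \<open>avoiding_set\<close> exclude both.\<close>

lemma heavy_anchors_separated:
  assumes rep: "grounded_string_rep V E c \<gamma>"
    and K: "heavy_comp s t K" "heavy_comp s t K'" "K \<noteq> K'"
    and v: "v \<in> K" "\<not> E v s" "\<not> E v t" and v': "v' \<in> K'" "\<not> E v' s" "\<not> E v' t"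
  defines "a \<equiv> \<lambda>u. fst (pathstart (\<gamma> u))"
  defines "mid \<equiv> \<lambda>u. a s < a u \<and> a u < a t \<or> a t < a u \<and> a u < a s"
  shows "mid v \<longleftrightarrow> \<not> mid v'"
proof -
  have cK: "comp_union s t K" "connected_on E K" "comp_union s t K'" "connected_on E K'"
    using K by (auto simp: heavy_comp_def)
  have ne: "K \<noteq> {}" "K' \<noteq> {}" using v v' by auto
  have dis: "K \<inter> K' = {}" using comp_union_disjoint[OF cK(1,3,2,4)] K(3) by blast
  have st: "s \<in> V" "t \<in> V" "s \<noteq> t" "s \<notin> K" "t \<notin> K" "s \<notin> K'" "t \<notin> K'" "K \<subseteq> V" "K' \<subseteq> V"
    using cK(1,3) by (auto simp: comp_union_def)
  have out: "V - {s, t} - K \<noteq> {}" "V - {s, t} - K' \<noteq> {}" using v(1) v'(1) dis st by blast+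
  have nst: "\<not> E s t" using comp_union_not_adj[OF cK(1) ne(1) out(1)] .
  \<comment> \<open>Stated for general \<open>M\<close> and \<open>N\<close> so as to serve for
    \<open>K\<close> and \<open>K'\<close> in both orders; \<open>p\<close>, \<open>q\<close> and
    \<open>r\<close>, \<open>w\<close> absorb the possible orders of the anchors.\<close>
  have noncross: "\<not> (a p < a r \<and> a r < a q \<and> a q < a w) \<and> \<not> (a r < a p \<and> a p < a w \<and> a w < a q)"
    if M: "comp_union s t M" "connected_on E M" "comp_union s t N" "connected_on E N" "M \<inter> N = {}"
      "V - {s, t} - M \<noteq> {}" "V - {s, t} - N \<noteq> {}"
      and m: "m \<in> M" "\<not> E m t" and n: "n \<in> N" "\<not> E n s"
      and pq: "{p, q} \<subseteq> {s, m}" and rw: "{r, w} \<subseteq> {t, n}" for M N m n p q r w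
  proof -
    have sub: "M \<subseteq> V" "N \<subseteq> V" "s \<notin> M" "t \<notin> M" "s \<notin> N" "t \<notin> N" using M(1,3) by (auto simp: comp_union_def)
    have out': "V - {t, s} - M \<noteq> {}" using M(6) by (simp add: insert_commute)
    obtain X x where X: "X \<subseteq> M" "connected_on E X" "m \<in> X" "\<forall>x\<in>X. \<not> E x t" "x \<in> X" "E x s"
      using avoiding_set[OF comp_union_sym[OF M(1)] M(2) out' m] by blast
    obtain Y y where Y: "Y \<subseteq> N" "connected_on E Y" "n \<in> Y" "\<forall>x\<in>Y. \<not> E x s" "y \<in> Y" "E y t"
      using avoiding_set[OF M(3,4,7) n] by blast
    have con: "connected_on E (insert s X)" "connected_on E (insert t Y)"
      using connected_on_insert[OF X(2,5,6)] connected_on_insert[OF Y(2,5,6)] by auto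
    have subs: "insert s X \<subseteq> V" "insert t Y \<subseteq> V" using X(1) Y(1) sub st by blast+
    have mem: "p \<in> insert s X" "q \<in> insert s X" "r \<in> insert t Y" "w \<in> insert t Y" using pq rw X(3) Y(3) by blast+
    have d: "insert s X \<inter> insert t Y = {}" using X(1) Y(1) M(5) sub st by blast
    have e: "\<not> E x' y'" if xy: "x' \<in> insert s X" "y' \<in> insert t Y" for x' y'
    proof -
      have "\<not> E x' y'" if "x' \<in> X" "y' \<in> Y"
        using comp_union_nbr[OF M(1), of x' y'] that X(1) Y(1) M(5) sub by blast
      then show ?thesis using xy nst X(4) Y(4) adj_sym by blast
    qed
    have e': "\<not> E y' x'" if "y' \<in> insert t Y" "x' \<in> insert s X" for x' y' using e that adj_sym by blast
    show ?thesis
      using anchors_not_interlaced[OF rep subs(1) con(1) mem(1,2) subs(2) con(2) mem(3,4) d e]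
        anchors_not_interlaced[OF rep subs(2) con(2) mem(3,4) subs(1) con(1) mem(1,2) _ e'] d
      unfolding a_def by blast
  qed
  note 1 = noncross[OF cK dis out v(1,3) v'(1,2)]
  have dis': "K' \<inter> K = {}" using dis by blast
  note 2 = noncross[OF cK(3,4,1,2) dis' out(2,1) v'(1,3) v(1,2)]
  have vv': "\<not> E v v'" "v \<noteq> v'" using comp_union_nbr[OF cK(1) v(1), of v'] v'(1) dis st v(1) by blast+
  have neq: "a v \<noteq> a v'" "a v \<noteq> a s" "a v \<noteq> a t" "a v' \<noteq> a s" "a v' \<noteq> a t" "a s \<noteq> a t"
    unfolding a_def using anchor_neq[OF rep] vv' v v' st nst by (metis subsetD)+
  have i1: "\<not> (a s < a t \<and> a t < a v \<and> a v < a v')" "\<not> (a t < a s \<and> a s < a v' \<and> a v' < a v)"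
    "\<not> (a s < a v' \<and> a v' < a v \<and> a v < a t)" "\<not> (a v' < a s \<and> a s < a t \<and> a t < a v)"
    "\<not> (a v < a t \<and> a t < a s \<and> a s < a v')" "\<not> (a t < a v \<and> a v < a v' \<and> a v' < a s)"
    "\<not> (a v < a v' \<and> a v' < a s \<and> a s < a t)" "\<not> (a v' < a v \<and> a v < a t \<and> a t < a s)"
    using 1[of s v t v'] 1[of s v v' t] 1[of v s t v'] 1[of v s v' t] by auto
  have i2: "\<not> (a s < a t \<and> a t < a v' \<and> a v' < a v)" "\<not> (a t < a s \<and> a s < a v \<and> a v < a v')"
    "\<not> (a s < a v \<and> a v < a v' \<and> a v' < a t)" "\<not> (a v < a s \<and> a s < a t \<and> a t < a v')"
    "\<not> (a v' < a t \<and> a t < a s \<and> a s < a v)" "\<not> (a t < a v' \<and> a v' < a v \<and> a v < a s)"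
    "\<not> (a v' < a v \<and> a v < a s \<and> a s < a t)" "\<not> (a v < a v' \<and> a v' < a t \<and> a t < a s)"
    using 2[of s v' t v] 2[of s v' v t] 2[of v' s t v] 2[of v' s v t] by auto
  show ?thesis unfolding mid_def using i1 i2 neq by (smt (verit))
qed

lemma outerstring_imp_at_most_2_heavy:
  assumes "outerstring V E"
  shows "at_most_2_heavy V E"
  unfolding at_most_2_heavy_def
proof (intro allI impI, rule ccontr)
  obtain c \<gamma> where rep: "grounded_string_rep V E c \<gamma>" using assms by (auto simp: outerstring_def)
  fix s t assume sep: "separation_pair V E s t"
    and many: "\<not> card {C \<in> components_of E (V - {s, t}). heavy E s t C} \<le> 2"
  let ?H = "{C \<in> components_of E (V - {s, t}). heavy E s t C}"
  have st: "s \<in> V" "t \<in> V" "s \<noteq> t" using sep by (auto simp: separation_pair_def)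
  have "3 \<le> card ?H" using many by simp
  then obtain T where T: "T \<subseteq> ?H" "card T = 3" by (rule obtain_subset_with_card_n)
  then obtain K1 K2 K3 where T3: "T = {K1, K2, K3}" and neq: "K1 \<noteq> K2" "K1 \<noteq> K3" "K2 \<noteq> K3"
    unfolding card_3_iff by blast
  have hc: "heavy_comp s t K" if "K \<in> T" for K
    using that T(1) component_iff[OF st, of K] unfolding heavy_comp_def by blast
  then have K: "heavy_comp s t K1" "heavy_comp s t K2" "heavy_comp s t K3" using T3 by auto
  obtain v1 v2 v3 where v: "v1 \<in> K1" "\<not> E v1 s" "\<not> E v1 t" "v2 \<in> K2" "\<not> E v2 s" "\<not> E v2 t"
    "v3 \<in> K3" "\<not> E v3 s" "\<not> E v3 t"
    using K unfolding heavy_comp_def heavy_def by blast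
  \<comment> \<open>Three truth values of \<open>mid\<close> cannot be pairwise different.\<close>
  show False
    using heavy_anchors_separated[OF rep K(1,2) neq(1) v(1-3) v(4-6)]
      heavy_anchors_separated[OF rep K(1,3) neq(2) v(1-3) v(7-9)]
      heavy_anchors_separated[OF rep K(2,3) neq(3) v(4-6) v(7-9)] by argo
qed

end

subsection \<open>From insertion sequences to L-shapes\<close>

lemma exists_real_between_finite:
  fixes A B :: "real set"
  assumes "finite A" "finite B" "\<And>a b. a \<in> A \<Longrightarrow> b \<in> B \<Longrightarrow> a < b"
  shows "\<exists>x. (\<forall>a\<in>A. a < x) \<and> (\<forall>b\<in>B. x < b)"
proof (cases "A = {} \<or> B = {}")
  case True
  obtain M m where "\<forall>a\<in>A. a \<le> M" "\<forall>b\<in>B. m \<le> b"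
    using assms(1,2) bdd_above_finite bdd_below_finite unfolding bdd_above_def bdd_below_def by metis
  then have "(\<forall>a\<in>A. a < M + 1) \<and> (\<forall>b\<in>B. m - 1 < b)" by fastforce
  then show ?thesis using True by blast
next
  case False
  then have "Max A < Min B" using assms by simp
  then obtain x where "Max A < x" "x < Min B" using dense by blast
  then show ?thesis using assms(1,2) False by (intro exI[of _ x]) auto
qed

context sgraph
begin

text \<open>Anchors \<open>x\<close>, depths \<open>h\<close> and endpoints \<open>x'\<close> of the horizontal segments of an L-representation.\<close>

definition L_layout :: "'a list \<Rightarrow> ('a \<Rightarrow> real) \<Rightarrow> ('a \<Rightarrow> real) \<Rightarrow> ('a \<Rightarrow> real) \<Rightarrow> bool" where
  "L_layout L x h x' \<longleftrightarrow> sorted_wrt (\<lambda>u v. x u < x v) L \<and> (\<forall>v\<in>set L. 0 < h v) \<and> inj_on h (set L) \<and>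
     (\<forall>u\<in>set L. \<forall>v\<in>set L. h v < h u \<longrightarrow> (E v u \<longleftrightarrow> x u \<in> closed_segment (x v) (x' v)))"

text \<open>The new depth is positive but smaller than all earlier ones, so in every new pair the
  segment of \<open>w\<close> decides, and the old pairs are untouched.\<close>

lemma L_layout_insert:
  assumes L: "L_layout (P @ R) x h x'" and w: "w \<notin> set (P @ R)"
    and \<xi>: "\<forall>u\<in>set P. x u < \<xi>" "\<forall>u\<in>set R. \<xi> < x u"
    and seg: "\<forall>u\<in>set (P @ R). E w u \<longleftrightarrow> x u \<in> closed_segment \<xi> \<xi>'"
  shows "\<exists>x h x'. L_layout (P @ w # R) x h x'"
proof -
  have "\<exists>\<eta>. (\<forall>a\<in>{0}. a < \<eta>) \<and> (\<forall>b\<in>h ` set (P @ R). \<eta> < b)"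
    by (rule exists_real_between_finite) (use L in \<open>auto simp: L_layout_def\<close>)
  then obtain \<eta> where \<eta>: "0 < \<eta>" "\<And>u. u \<in> set (P @ R) \<Longrightarrow> \<eta> < h u" by blast
  let ?x = "x(w := \<xi>)" and ?h = "h(w := \<eta>)" and ?x' = "x'(w := \<xi>')"
  have old: "?x u = x u" "?h u = h u" "?x' u = x' u" if "u \<in> set (P @ R)" for u using that w by auto
  have set: "set (P @ w # R) = insert w (set (P @ R))" by auto
  have sorted: "sorted_wrt (\<lambda>u v. ?x u < ?x v) (P @ w # R)"
  proof -
    have "sorted_wrt (\<lambda>u v. ?x u < ?x v) (P @ R)"
      by (rule sorted_wrt_mono_rel[of _ "\<lambda>u v. x u < x v"]) (use L w in \<open>auto simp: L_layout_def\<close>)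
    then show ?thesis using \<xi> w by (auto simp: sorted_wrt_append)
  qed
  have pos: "\<forall>v\<in>set (P @ w # R). 0 < ?h v" using L \<eta>(1) by (auto simp: L_layout_def)
  have inj: "inj_on ?h (set (P @ w # R))"
    unfolding set
  proof (rule inj_on_insert[THEN iffD2], intro conjI)
    have "inj_on h (set (P @ R))" using L by (simp add: L_layout_def)
    then show "inj_on ?h (set (P @ R))" using old by (simp add: inj_on_def)
    show "?h w \<notin> ?h ` (set (P @ R) - {w})" using old \<eta>(2) by fastforce
  qed
  have adj: "E v u \<longleftrightarrow> ?x u \<in> closed_segment (?x v) (?x' v)"
    if uv: "u \<in> set (P @ w # R)" "v \<in> set (P @ w # R)" "?h v < ?h u" for u v
  proof -
    have u: "u \<in> set (P @ R)"
    proof (rule ccontr)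
      assume "u \<notin> set (P @ R)"
      then have "u = w" using uv(1) by auto
      moreover have "v \<in> set (P @ R)" using uv(2,3) \<open>u = w\<close> by auto
      ultimately show False using uv(3) \<eta>(2)[of v] old(2)[of v] by simp
    qed
    show ?thesis
    proof (cases "v = w")
      case True
      then show ?thesis using seg u old(1)[OF u] by simp
    next
      case False
      then have "v \<in> set (P @ R)" using uv(2) by auto
      then show ?thesis using L u uv(3) old unfolding L_layout_def by simp
    qed
  qed
  show ?thesis unfolding L_layout_def using sorted pos inj adj by blast
qed

lemma L_layout_ins:
  assumes "ins L L'" "L_layout L x h x'"
  shows "\<exists>x h x'. L_layout L' x h x'"
  using assms
proof (induction rule: ins.induct)
  case (ins_before w p q r)
  have s: "sorted_wrt (\<lambda>u v. x u < x v) (p @ q @ r)" using ins_before by (simp add: L_layout_def)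
  have "\<exists>\<xi>. (\<forall>a\<in>x ` set p. a < \<xi>) \<and> (\<forall>b\<in>x ` set (q @ r). \<xi> < b)"
    by (rule exists_real_between_finite) (use s in \<open>auto simp: sorted_wrt_append\<close>)
  then obtain \<xi> where \<xi>: "\<forall>u\<in>set p. x u < \<xi>" "\<forall>u\<in>set (q @ r). \<xi> < x u" by blast
  \<comment> \<open>Including \<open>\<xi>\<close> among the lower bounds makes the segment run to
    the right even if \<open>q\<close> is empty.\<close>
  have "\<exists>\<xi>'. (\<forall>a\<in>insert \<xi> (x ` set q). a < \<xi>') \<and> (\<forall>b\<in>x ` set r. \<xi>' < b)"
    by (rule exists_real_between_finite) (use s \<xi> in \<open>auto simp: sorted_wrt_append\<close>)
  then obtain \<xi>' where \<xi>': "\<xi> < \<xi>'" "\<forall>u\<in>set q. x u < \<xi>'" "\<forall>u\<in>set r. \<xi>' < x u" by blast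
  have "E w u \<longleftrightarrow> x u \<in> closed_segment \<xi> \<xi>'" if u: "u \<in> set (p @ q @ r)" for u
  proof -
    have "u \<in> set q \<longleftrightarrow> x u \<in> closed_segment \<xi> \<xi>'"
      using u \<xi> \<xi>' by (force simp: closed_segment_eq_real_ivl)
    then show ?thesis using ins_before(2) u by blast
  qed
  then show ?case
    by (intro L_layout_insert[OF ins_before(3,1) \<xi>]) blast
next
  case (ins_after w p q r)
  have s: "sorted_wrt (\<lambda>u v. x u < x v) (p @ q @ r)" using ins_after by (simp add: L_layout_def)
  have "\<exists>\<xi>. (\<forall>a\<in>x ` set (p @ q). a < \<xi>) \<and> (\<forall>b\<in>x ` set r. \<xi> < b)"
    by (rule exists_real_between_finite) (use s in \<open>auto simp: sorted_wrt_append\<close>)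
  then obtain \<xi> where \<xi>: "\<forall>u\<in>set (p @ q). x u < \<xi>" "\<forall>u\<in>set r. \<xi> < x u" by blast
  have "\<exists>\<xi>'. (\<forall>a\<in>x ` set p. a < \<xi>') \<and> (\<forall>b\<in>insert \<xi> (x ` set q). \<xi>' < b)"
    by (rule exists_real_between_finite) (use s \<xi> in \<open>auto simp: sorted_wrt_append\<close>)
  then obtain \<xi>' where \<xi>': "\<xi>' < \<xi>" "\<forall>u\<in>set q. \<xi>' < x u" "\<forall>u\<in>set p. x u < \<xi>'" by blast
  have "E w u \<longleftrightarrow> x u \<in> closed_segment \<xi> \<xi>'" if u: "u \<in> set (p @ q @ r)" for u
  proof -
    have "u \<in> set q \<longleftrightarrow> x u \<in> closed_segment \<xi> \<xi>'"
      using u \<xi> \<xi>' by (force simp: closed_segment_eq_real_ivl)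
    then show ?thesis using ins_after(2) u by blast
  qed
  then have "\<exists>x h x'. L_layout ((p @ q) @ w # r) x h x'"
    by (intro L_layout_insert[OF _ _ \<xi>, where \<xi>' = \<xi>' and x' = x' and h = h]) (use ins_after(1,3) in simp_all)
  then show ?case by simp
qed

lemma L_layout_exists:
  assumes "ins\<^sup>*\<^sup>* [] L"
  shows "\<exists>x h x'. L_layout L x h x'"
  using assms
proof (induction rule: rtranclp_induct)
  case base
  show ?case by (simp add: L_layout_def)
next
  case (step L L')
  then show ?case using L_layout_ins by blast
qed

end

text \<open>The ground line is at height 0 and \<open>h\<close> is a depth. The case
  \<open>x' = x\<close> is separate because joining a constant path would destroy
  injectivity.\<close>

definition L_curve :: "real \<Rightarrow> real \<Rightarrow> real \<Rightarrow> real \<Rightarrow> real \<times> real" where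
  "L_curve x h x' = (if x' = x then linepath (x, 0) (x, - h)
     else linepath (x, 0) (x, - h) +++ linepath (x, - h) (x', - h))"

lemma path_image_L_curve:
  "path_image (L_curve x h x') = closed_segment (x, 0) (x, - h) \<union> closed_segment (x, - h) (x', - h)"
  by (auto simp: L_curve_def path_image_join)

lemma pathstart_L_curve [simp]: "pathstart (L_curve x h x') = (x, 0)"
  by (simp add: L_curve_def)

lemma closed_segment_vertical: "closed_segment (x, a) (x, b) = {x} \<times> closed_segment a b" for x a b :: real
proof -
  have "(1 - u) * x + u * x = x" for u by (simp add: algebra_simps)
  then show ?thesis by (auto simp: closed_segment_def)
qed

lemma closed_segment_horizontal: "closed_segment (a, y) (b, y) = closed_segment a b \<times> {y}" for y a b :: real
proof -
  have "(1 - u) * y + u * y = y" for u by (simp add: algebra_simps)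
  then show ?thesis by (auto simp: closed_segment_def)
qed

lemma arc_L_curve:
  assumes "0 < h"
  shows "arc (L_curve x h x')"
proof (cases "x' = x")
  case True
  then show ?thesis using assms by (simp add: L_curve_def arc_linepath)
next
  case False
  have "arc (linepath (x, 0) (x, - h) +++ linepath (x, - h) (x', - h))"
    by (rule arc_join) (use assms False in \<open>auto simp: arc_linepath closed_segment_vertical closed_segment_horizontal\<close>)
  then show ?thesis using False by (simp add: L_curve_def)
qed

lemma L_curve_below:
  assumes "0 < h" "\<tau> \<in> {0<..1}"
  shows "snd (L_curve x h x' \<tau>) < 0"
  using assms by (auto simp: L_curve_def joinpaths_def linepath_def algebra_simps mult_pos_pos)

text \<open>The vertical parts are disjoint as \<open>a \<noteq> b\<close>, and the horizontal part
  at depth \<open>h\<close> lies below the whole other curve. The only possible meeting point is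
  \<open>(a, - k)\<close>, on the vertical part at \<open>a\<close> and the horizontal part at depth
  \<open>k\<close>.\<close>

lemma L_curves_meet:
  assumes "a \<noteq> b" "0 < k" "k < h"
  shows "path_image (L_curve a h a') \<inter> path_image (L_curve b k b') \<noteq> {} \<longleftrightarrow> a \<in> closed_segment b b'"
proof
  assume "a \<in> closed_segment b b'"
  then have "(a, - k) \<in> path_image (L_curve a h a') \<inter> path_image (L_curve b k b')"
    using assms by (auto simp: path_image_L_curve closed_segment_vertical closed_segment_horizontal closed_segment_eq_real_ivl)
  then show "path_image (L_curve a h a') \<inter> path_image (L_curve b k b') \<noteq> {}" by blast
next
  assume "path_image (L_curve a h a') \<inter> path_image (L_curve b k b') \<noteq> {}"
  then obtain z where "z \<in> path_image (L_curve a h a')" "z \<in> path_image (L_curve b k b')" by blast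
  then show "a \<in> closed_segment b b'"
    using assms by (auto simp: path_image_L_curve closed_segment_vertical closed_segment_horizontal
        closed_segment_eq_real_ivl[of 0] split: if_splits)
qed

context sgraph
begin

lemma ins_imp_grounded_L_mirror_rep:
  assumes "ins\<^sup>*\<^sup>* [] L" "set L = V"
  shows "grounded_L_mirror_rep V E"
proof -
  obtain x h x' where L: "L_layout L x h x'" using L_layout_exists[OF assms(1)] by blast
  define \<gamma> where "\<gamma> v = L_curve (x v) (h v) (x' v)" for v
  have pos: "0 < h v" if "v \<in> V" for v using L that assms(2) by (simp add: L_layout_def)
  have xneq: "x u \<noteq> x v" if "u \<in> V" "v \<in> V" "u \<noteq> v" for u v
  proof -
    have "sorted_wrt (\<lambda>u v. x u < x v) L" using L by (simp add: L_layout_def)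
    then have "u = v \<or> x u < x v \<or> x v < x u" if "u \<in> set L" "v \<in> set L" for u v
      using that by (induction L) auto
    then show ?thesis using that assms(2) by fastforce
  qed
  have hneq: "h u \<noteq> h v" if "u \<in> V" "v \<in> V" "u \<noteq> v" for u v
    using L that assms(2) unfolding L_layout_def inj_on_def by blast
  have meet: "path_image (\<gamma> u) \<inter> path_image (\<gamma> v) \<noteq> {} \<longleftrightarrow> E u v" if "u \<in> V" "v \<in> V" "h v < h u" for u v
  proof -
    have "u \<noteq> v" using that by auto
    then have "path_image (\<gamma> u) \<inter> path_image (\<gamma> v) \<noteq> {} \<longleftrightarrow> x u \<in> closed_segment (x v) (x' v)"
      unfolding \<gamma>_def using L_curves_meet[of "x u" "x v" "h v" "h u"] xneq that pos by blast
    also have "\<dots> \<longleftrightarrow> E v u" using L that assms(2) unfolding L_layout_def by blast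
    finally show ?thesis using adj_sym by blast
  qed
  have "path_image (\<gamma> u) \<inter> path_image (\<gamma> v) \<noteq> {} \<longleftrightarrow> E u v" if "u \<in> V" "v \<in> V" "u \<noteq> v" for u v
    using meet[of u v] meet[of v u] hneq[OF that] that adj_sym by (metis Int_commute linorder_neqE)
  then have "grounded_string_rep V E 0 \<gamma>"
    unfolding grounded_string_rep_def \<gamma>_def using arc_L_curve L_curve_below pos by auto
  moreover have "L_shape 0 (path_image (\<gamma> v))" if "v \<in> V" for v
    unfolding L_shape_def \<gamma>_def path_image_L_curve using pos[OF that] by (metis neg_less_0_iff_less)
  ultimately show ?thesis unfolding grounded_L_mirror_rep_def by blast
qed

end

theorem theorem3:
  fixes V :: "'a set" and E :: "'a \<Rightarrow> 'a \<Rightarrow> bool"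
  assumes "simple_graph V E"
    and "biconnected V E"
    and "series_parallel V E"
    and "no_transitive_edges V E"
  shows "(at_most_2_heavy V E \<longleftrightarrow> outerstring V E)
       \<and> (outerstring V E \<longleftrightarrow> grounded_L_mirror_rep V E)"
proof -
  interpret sp_graph V E
    by unfold_locales (use assms in \<open>simp_all add: series_parallel_def\<close>)
  have "grounded_L_mirror_rep V E" if heavy2: "at_most_2_heavy V E"
  proof -
    obtain s t where "E s t" "good_root {s, t}" using good_root_exists[OF heavy2] by blast
    then obtain L where "ins\<^sup>*\<^sup>* [] L" "set L = V" using ins_all by blast
    then show ?thesis by (rule ins_imp_grounded_L_mirror_rep)
  qed
  moreover have "grounded_L_mirror_rep V E \<Longrightarrow> outerstring V E"
    by (auto simp: grounded_L_mirror_rep_def outerstring_def)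
  ultimately show ?thesis using outerstring_imp_at_most_2_heavy by blast
qed

end
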